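(* Let $k$ be a fixed number of clusters and let $a>b$ be constants with $a+(k-1)b>k$. Fix a node $v\in[n]$ and let $(G,R,\sigma)\sim\mathcal G(n,k,a,b,p)$. If the predicate $\theta_k(a,b)=\pi_k\!\left(\frac{a+(k-1)b}{k},\frac{b}{a+(k-1)b}\right)$ is not satisfied, then for all $i\in\{1,\dots,k\}$, $$\lim_{p\to0}\lim_{n\to\infty}\Pr[\sigma_v=i\mid G,R,\sigma_R]=\frac1k,\qquad\text{a.a.s.}$$
   Context: Labeled stochastic block model $\mathcal G(n,k,a,b,p)$: each node $v\in[n]$ independently receives a uniformly random label $\sigma_v\in\{1,\dots,k\}$. Given the labels, each pair $u\ne v$ is joined by an edge independently, with probability $a/n$ if $\sigma_u=\sigma_v$ and $b/n$ otherwise. Independently, each node is placed in the revealed set $R$ independently with probability $p$. $\sigma_R$ is the restriction of $\sigma$ to $R$. Broadcast process $\mathcal T(T,k,\eta)$ on a rooted tree $T$ with root $\rho$, $\eta<1/k$: $\tau_\rho$ is uniform in $\{1,\dots,k\}$. Along each edge $(u,v)$ directed away from the root, given $\tau_u$ and conditionally independently of the rest, $\tau_v=\tau_u$ with probability $1-(k-1)\eta$, and otherwise $\tau_v$ is a uniformly random label different from $\tau_u$. $\partial T_r$ is the set of nodes at distance exactly $r$ from the root, and $\tau_{\partial T_r}$ denotes the labels there. Predicate $\pi_k(d,\eta)$: let $T$ be a Galton–Watson tree with average degree $d>1$ (in the application to the block model, with offspring distribution $\mathrm{Poisson}(d)$), and let $(T,\tau)\sim\mathcal T(T,k,\eta)$.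 It is a separately stated fact that there exists a predicate $\pi_k(d,\eta)$, monotonically decreasing in $\eta$ and monotonically increasing in $d$, such that if $\pi_k(d,\eta)$ is false, then for each $i\in\{1,\dots,k\}$, $\lim_{r\to\infty}\Pr[\tau_\rho=i\mid\tau_{\partial T_r}]\to\frac1k$ a.a.s. $\pi_k$ denotes this predicate. Only this one direction (falsity implies non-reconstruction) is asserted of it. For $k=2$, $\pi_2(d,\eta)$ is the condition $d(1-2\eta)^2>1$. "a.a.s." means asymptotically almost surely; the posterior probabilities are random variables. *)

theory Defs
  imports "HOL-Probability.Probability"
begin

text \<open>
  The posterior probability of the event \<open>A\<close> given the observation \<open>Y\<close>, as a random variable
  on the (discrete) sample space of \<open>M\<close>.
\<close>

definition posterior :: "'w pmf \<Rightarrow> ('w \<Rightarrow> bool) \<Rightarrow> ('w \<Rightarrow> 'o) \<Rightarrow> 'w \<Rightarrow> real" where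
  "posterior M A Y \<omega> = cond_prob (measure_pmf M) A (\<lambda>\<omega>'. Y \<omega>' = Y \<omega>)"

definition random_subset :: "'a set \<Rightarrow> ('a \<Rightarrow> real) \<Rightarrow> 'a set pmf" where
  "random_subset A q =
     map_pmf (\<lambda>f. {x \<in> A. f x}) (Pi_pmf A False (\<lambda>x. bernoulli_pmf (q x)))"


section \<open>The labeled stochastic block model\<close>

text \<open>
  The node set is \<open>{1..n}\<close>, and a simple graph on it is represented by its set of edges, each edge
  being a two-element set of nodes. An outcome is a triple of graph, revealed set and labelling
  (which has the dummy value 0 outside \<open>{1..n}\<close>). The library's Bernoulli distribution clips its
  parameter to \<open>[0, 1]\<close>, which matters only for the finitely many \<open>n < a\<close>.
\<close>

definition pairs :: "nat \<Rightarrow> nat set set" where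
  "pairs n = {e. e \<subseteq> {1..n} \<and> card e = 2}"

definition labeled_sbm ::
    "nat \<Rightarrow> nat \<Rightarrow> real \<Rightarrow> real \<Rightarrow> real \<Rightarrow> (nat set set \<times> nat set \<times> (nat \<Rightarrow> nat)) pmf" where
  "labeled_sbm n k a b p =
     do {
       \<sigma> \<leftarrow> Pi_pmf {1..n} 0 (\<lambda>_. pmf_of_set {1..k});
       G \<leftarrow> random_subset (pairs n)
              (\<lambda>e. if \<forall>u\<in>e. \<forall>v\<in>e. \<sigma> u = \<sigma> v then a / real n else b / real n);
       R \<leftarrow> random_subset {1..n} (\<lambda>_. p);
       return_pmf (G, R, \<sigma>)
     }"

text \<open>\<open>Pr[\<sigma>\<^sub>v = i | G, R, \<sigma>\<^sub>R]\<close>\<close>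

definition sbm_posterior ::
    "nat \<Rightarrow> nat \<Rightarrow> real \<Rightarrow> real \<Rightarrow> real \<Rightarrow> nat \<Rightarrow> nat
     \<Rightarrow> nat set set \<times> nat set \<times> (nat \<Rightarrow> nat) \<Rightarrow> real" where
  "sbm_posterior n k a b p v i =
     posterior (labeled_sbm n k a b p) (\<lambda>(G, R, \<sigma>). \<sigma> v = i) (\<lambda>(G, R, \<sigma>). (G, R, restrict \<sigma> R))"


section \<open>Broadcasting on Galton--Watson trees\<close>

text \<open>
  Finite rooted ordered trees with labels of type \<open>'a\<close>; an unlabelled tree has labels of type
  \<open>unit\<close>.
\<close>

datatype 'a rtree = Node (root: 'a) (subtrees: "'a rtree list")

text \<open>\<open>gw_tree q r\<close> is the law of the Galton--Watson tree with offspring law \<open>q\<close>, cut off below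
  generation \<open>r\<close>.\<close>

primrec gw_tree :: "nat pmf \<Rightarrow> nat \<Rightarrow> unit rtree pmf" where
  "gw_tree q 0 = return_pmf (Node () [])"
| "gw_tree q (Suc r) =
     do {
       m \<leftarrow> q;
       ts \<leftarrow> replicate_pmf m (gw_tree q r);
       return_pmf (Node () ts)
     }"

text \<open>A list of independent samples, one from each of the given distributions.\<close>

primrec sequence_pmf :: "'a pmf list \<Rightarrow> 'a list pmf" where
  "sequence_pmf [] = return_pmf []"
| "sequence_pmf (p # ps) = do { x \<leftarrow> p; xs \<leftarrow> sequence_pmf ps; return_pmf (x # xs) }"

definition broadcast_edge :: "nat \<Rightarrow> real \<Rightarrow> nat \<Rightarrow> nat pmf" where
  "broadcast_edge k \<eta> s =
     do {
       keep \<leftarrow> bernoulli_pmf (1 - (real k - 1) * \<eta>);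
       if keep then return_pmf s else pmf_of_set ({1..k} - {s})
     }"

fun broadcast_from :: "nat \<Rightarrow> real \<Rightarrow> nat \<Rightarrow> unit rtree \<Rightarrow> nat rtree pmf" where
  "broadcast_from k \<eta> s (Node _ ts) =
     map_pmf (Node s)
       (sequence_pmf
         (map (\<lambda>t. do { s' \<leftarrow> broadcast_edge k \<eta> s; broadcast_from k \<eta> s' t }) ts))"

definition broadcast :: "nat \<Rightarrow> real \<Rightarrow> unit rtree \<Rightarrow> nat rtree pmf" where
  "broadcast k \<eta> T = do { s \<leftarrow> pmf_of_set {1..k}; broadcast_from k \<eta> s T }"

text \<open>The labels at distance exactly \<open>r\<close> from the root, from left to right.\<close>

fun level :: "nat \<Rightarrow> 'a rtree \<Rightarrow> 'a list" where
  "level 0 (Node x ts) = [x]"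
| "level (Suc r) (Node x ts) = concat (map (level r) ts)"

text \<open>\<open>Pr[\<tau>\<^sub>\<rho> = i | \<tau>\<^sub>\<partial>\<^sub>T\<^sub>r]\<close> for the broadcast process on the tree \<open>T\<close>\<close>

definition root_posterior :: "nat \<Rightarrow> real \<Rightarrow> nat \<Rightarrow> nat \<Rightarrow> unit rtree \<Rightarrow> nat rtree \<Rightarrow> real" where
  "root_posterior k \<eta> r i T = posterior (broadcast k \<eta> T) (\<lambda>\<tau>. root \<tau> = i) (level r)"

definition gw_broadcast :: "nat \<Rightarrow> real \<Rightarrow> real \<Rightarrow> nat \<Rightarrow> (unit rtree \<times> nat rtree) pmf" where
  "gw_broadcast k d \<eta> r =
     do {
       T \<leftarrow> gw_tree (poisson_pmf d) r;
       \<tau> \<leftarrow> broadcast k \<eta> T;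
       return_pmf (T, \<tau>)
     }"

text \<open>
  The posterior of the root given generation \<open>r\<close> tends to \<open>1 / k\<close> in probability. Both this
  posterior and its law depend only on the first \<open>r\<close> generations, so the tree may be cut off there.
\<close>

definition nonreconstruction :: "nat \<Rightarrow> real \<Rightarrow> real \<Rightarrow> bool" where
  "nonreconstruction k d \<eta> \<longleftrightarrow>
     (\<forall>i\<in>{1..k}. \<forall>\<epsilon>>0.
        (\<lambda>r. measure_pmf.prob (gw_broadcast k d \<eta> r)
               {(T, \<tau>). \<bar>root_posterior k \<eta> r i T \<tau> - 1 / real k\<bar> > \<epsilon>}) \<longlonglongrightarrow> 0)"

text \<open>
  What is known of the predicate \<open>\<pi>\<^sub>k\<close>: monotonicity, that its falsity implies non-reconstruction
  (the converse is not claimed), and its explicit form for two labels.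
\<close>

definition reconstruction_predicate :: "nat \<Rightarrow> (real \<Rightarrow> real \<Rightarrow> bool) \<Rightarrow> bool" where
  "reconstruction_predicate k \<pi> \<longleftrightarrow>
     (\<forall>d \<eta> \<eta>'. 1 < d \<and> 0 \<le> \<eta> \<and> \<eta> \<le> \<eta>' \<and> \<eta>' < 1 / real k \<longrightarrow> \<pi> d \<eta>' \<longrightarrow> \<pi> d \<eta>) \<and>
     (\<forall>d d' \<eta>. 1 < d \<and> d \<le> d' \<and> 0 \<le> \<eta> \<and> \<eta> < 1 / real k \<longrightarrow> \<pi> d \<eta> \<longrightarrow> \<pi> d' \<eta>) \<and>
     (\<forall>d \<eta>. 1 < d \<and> 0 \<le> \<eta> \<and> \<eta> < 1 / real k \<longrightarrow> \<not> \<pi> d \<eta> \<longrightarrow> nonreconstruction k d \<eta>) \<and>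
     (k = 2 \<longrightarrow> (\<forall>d \<eta>. 1 < d \<and> 0 \<le> \<eta> \<and> \<eta> < 1 / 2 \<longrightarrow> (\<pi> d \<eta> \<longleftrightarrow> d * (1 - 2 * \<eta>)\<^sup>2 > 1)))"

definition theta :: "(real \<Rightarrow> real \<Rightarrow> bool) \<Rightarrow> nat \<Rightarrow> real \<Rightarrow> real \<Rightarrow> bool" where
  "theta \<pi> k a b =
     \<pi> ((a + (real k - 1) * b) / real k) (b / (a + (real k - 1) * b))"

end

theory Submission
  imports Defs "HOL-Combinatorics.Multiset_Permutations" "HOL-Real_Asymp.Real_Asymp"
begin

text \<open>
  By duality, the mean deviation of a posterior from \<open>1 / k\<close> is the supremum of
  \<open>E ((of_bool (\<sigma> v = i) - 1 / k) * f Y)\<close> over all functions \<open>f\<close> of the observation \<open>Y\<close> that are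
  bounded by 1. Fix \<open>r\<close> and a finite set of shapes that carries almost all of the mass of the
  Galton--Watson tree of height \<open>r\<close>. Decompose the expectation according to the embedded tree found
  by exploring the graph from \<open>v\<close> up to depth \<open>r\<close>, an ordered tree \<open>T\<close> being counted with weight
  one over the product of the factorials of its numbers of children, because every exploration can
  be ordered in that many ways. If no vertex at depth less than \<open>r\<close> is revealed, the observation
  is a function of the graph outside the explored vertices and of the labels off the inner vertices
  of \<open>T\<close>. The missing edges at the inner vertices contribute a product that concentrates around
  \<open>exp (- d * m)\<close>, where \<open>m\<close> is the number of inner vertices, by a second moment computation. What is
  left is, after summing over all embeddings of a shape, the probability of the shape times an
  expectation for the broadcast process, which is bounded by the deviation of the root posterior.
  So the limit superior over \<open>n\<close> is at most the mass of the neglected shapes, plus the probability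
  of revealing an inner vertex, plus the tree deviation, and the second term vanishes with \<open>p\<close>.
\<close>

section \<open>Ordered trees and the broadcast process\<close>

text \<open>The missing edges at an inner vertex also carry information about its label, and they
  involve the labels of almost all vertices. They are harmless because every label has the same mean
  affinity \<open>(a + (k - 1) * b) / k\<close> to a uniform label, so their likelihood averages to
  the same value whatever the labels of the tree. The constant that it approaches is also the
  product of the factors \<open>exp (- d)\<close> of the Poisson offspring laws, one for each inner
  vertex. The present edges have likelihood \<open>(d / n) ^ L\<close> times the density of the
  broadcast law with respect to independent uniform labels, where \<open>L\<close> is the number of
  edges. As there are about \<open>n ^ L\<close> embeddings, the powers of \<open>n\<close> cancel.
  The estimates are made one embedding at a time instead of by a coupling of the neighbourhood of
  \<open>v\<close> with a random tree. With the constant test function the same estimate bounds from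
  below the mass that the chosen shapes capture. The rest of the graph may depend on the tree
  through generation \<open>r\<close>: once the labels outside the tree are frozen, the averaged
  test function depends on nothing but the labels of that generation.\<close>

fun nodes :: "'a rtree \<Rightarrow> 'a list" where
  "nodes (Node x ts) = x # concat (map nodes ts)"

fun edges :: "'a rtree \<Rightarrow> ('a \<times> 'a) list" where
  "edges (Node x ts) = concat (map (\<lambda>t. (x, root t) # edges t) ts)"

fun weight :: "'a rtree \<Rightarrow> real" where
  "weight (Node x ts) = prod_list (map weight ts) / fact (length ts)"

text \<open>These are the nodes at depth less than \<open>r\<close>, childless ones included: an
  exploration up to depth \<open>r\<close> has seen all neighbours of exactly these nodes.\<close>

fun inner_nodes :: "nat \<Rightarrow> 'a rtree \<Rightarrow> 'a list" where
  "inner_nodes 0 T = []"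
| "inner_nodes (Suc r) (Node x ts) = x # concat (map (inner_nodes r) ts)"

fun height_le :: "nat \<Rightarrow> 'a rtree \<Rightarrow> bool" where
  "height_le 0 (Node x ts) \<longleftrightarrow> ts = []"
| "height_le (Suc r) (Node x ts) \<longleftrightarrow> (\<forall>t\<in>set ts. height_le r t)"

abbreviation shape :: "'a rtree \<Rightarrow> unit rtree" where
  "shape \<equiv> map_rtree (\<lambda>_. ())"

lemma root_map_rtree [simp]: "root (map_rtree f T) = f (root T)"
  by (cases T) auto

lemma nodes_map_rtree: "nodes (map_rtree f T) = map f (nodes T)"
  by (induction T) (auto simp: map_concat comp_def intro!: arg_cong[where f = concat])

lemma edges_map_rtree: "edges (map_rtree f T) = map (map_prod f f) (edges T)"
  by (induction T) (auto simp: map_concat comp_def intro!: arg_cong[where f = concat])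

lemma weight_map_rtree [simp]: "weight (map_rtree f T) = weight T"
  by (induction T) (auto simp: comp_def intro!: arg_cong[where f = prod_list])

lemma inner_nodes_map_rtree: "inner_nodes r (map_rtree f T) = map f (inner_nodes r T)"
  by (induction r T rule: inner_nodes.induct)
     (auto simp: map_concat comp_def intro!: arg_cong[where f = concat])

lemma level_map_rtree: "level r (map_rtree f T) = map f (level r T)"
  by (induction r T rule: level.induct)
     (auto simp: map_concat comp_def intro!: arg_cong[where f = concat])

lemma height_le_map_rtree [simp]: "height_le r (map_rtree f T) = height_le r T"
  by (induction r T rule: height_le.induct) auto

lemma root_in_nodes [simp]: "root T \<in> set (nodes T)"
  by (cases T) auto

lemma hd_nodes: "hd (nodes T) = root T"
  by (cases T) auto

lemma weight_nonneg: "weight T \<ge> 0"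
  by (induction T) (auto intro!: divide_nonneg_pos prod_list_nonneg)

lemma length_nodes: "length (nodes T) = Suc (length (edges T))"
proof (induction T)
  case (Node x ts)
  then show ?case
    by (induction ts) auto
qed

lemma mset_nodes: "height_le r T \<Longrightarrow> mset (nodes T) = mset (inner_nodes r T) + mset (level r T)"
proof (induction r T rule: height_le.induct)
  case (2 r x ts)
  then show ?case
    by (induction ts) auto
qed auto

lemma edges_subset: "set (edges T) \<subseteq> set (nodes T) \<times> set (nodes T)"
  by (induction T) fastforce

lemma edges_inner_nodes: "height_le r T \<Longrightarrow> e \<in> set (edges T) \<Longrightarrow> fst e \<in> set (inner_nodes r T)"
  by (induction r T rule: height_le.induct) auto

lemma exists_tree_with_nodes:
  "length xs = length (nodes t) \<Longrightarrow> \<exists>T. shape T = shape t \<and> nodes T = xs"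
proof (induction t arbitrary: xs)
  case (Node x ts)
  then obtain y ys where xs: "xs = y # ys" and ys: "length ys = length (concat (map nodes ts))"
    by (cases xs) auto
  have "\<exists>Ts. map shape Ts = map shape ts \<and> concat (map nodes Ts) = ys"
    using ys Node.IH
  proof (induction ts arbitrary: ys)
    case (Cons t ts)
    obtain T where "shape T = shape t" "nodes T = take (length (nodes t)) ys"
      using Cons.prems(2)[of t "take (length (nodes t)) ys"] Cons.prems(1) by auto
    moreover obtain Ts where "map shape Ts = map shape ts"
        "concat (map nodes Ts) = drop (length (nodes t)) ys"
      using Cons.IH[of "drop (length (nodes t)) ys"] Cons.prems by auto
    ultimately show ?case
      by (intro exI[of _ "T # Ts"]) auto
  qed auto
  then obtain Ts where "map shape Ts = map shape ts" "concat (map nodes Ts) = ys"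
    by blast
  then show ?case
    using xs by (intro exI[of _ "Node y Ts"]) auto
qed

lemma tree_eqI: "shape T = shape T' \<Longrightarrow> nodes T = nodes T' \<Longrightarrow> T = T'"
proof (induction T arbitrary: T')
  case (Node x ts)
  obtain y ts' where T': "T' = Node y ts'"
    by (cases T') auto
  have "map shape ts = map shape ts'" "concat (map nodes ts) = concat (map nodes ts')"
    using Node.prems T' by auto
  then have "ts = ts'"
    using Node.IH
  proof (induction ts arbitrary: ts')
    case (Cons t ts)
    obtain t' us where ts': "ts' = t' # us" and s: "shape t = shape t'"
      using Cons.prems(1) by (cases ts') auto
    have "length (nodes t) = length (nodes t')"
      by (metis length_map nodes_map_rtree s)
    then show ?case
      using Cons s ts' by auto
  qed auto
  then show ?case
    using Node.prems T' by auto
qed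

text \<open>The preorder list serves as a system of coordinates: trees of a fixed shape become lists
  of a fixed length, where finiteness and counting are settled.\<close>

lemma bij_betw_nodes: "bij_betw nodes {T. shape T = t} {xs. length xs = length (nodes t)}"
proof (rule bij_betwI')
  fix T assume "T \<in> {T. shape T = t}"
  then show "nodes T \<in> {xs. length xs = length (nodes t)}"
    by (auto simp: nodes_map_rtree)
next
  fix xs :: "'a list"
  assume "xs \<in> {xs. length xs = length (nodes t)}"
  moreover have "shape t = t"
    by (simp add: rtree.map_ident_strong)
  ultimately show "\<exists>T\<in>{T. shape T = t}. xs = nodes T"
    using exists_tree_with_nodes[of xs t] by auto
qed (auto intro: tree_eqI)

section \<open>Point masses of the Galton-Watson tree and of the broadcast process\<close>

lemma pmf_Cons_bind:
  "pmf (do { x \<leftarrow> p; xs \<leftarrow> q; return_pmf (x # xs) }) (y # ys) = pmf p y * pmf q ys"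
proof -
  have "do { x \<leftarrow> p; xs \<leftarrow> q; return_pmf (x # xs) } = map_pmf (\<lambda>(x, xs). x # xs) (pair_pmf p q)"
    by (simp add: pair_pmf_def map_bind_pmf)
  moreover have "inj (\<lambda>(x, xs). x # xs)"
    by (auto simp: inj_def)
  ultimately show ?thesis
    using pmf_map_inj'[of "\<lambda>(x, xs). x # xs" "pair_pmf p q" "(y, ys)"] by (simp add: pmf_pair)
qed

lemma pmf_sequence_pmf:
  "length xs = length ps \<Longrightarrow> pmf (sequence_pmf ps) xs = prod_list (map2 pmf ps xs)"
proof (induction ps arbitrary: xs)
  case (Cons p ps)
  then show ?case
    by (cases xs) (auto simp: pmf_Cons_bind)
qed auto

lemma set_sequence_pmf: "set_pmf (sequence_pmf ps) = {xs. list_all2 (\<lambda>x p. x \<in> set_pmf p) xs ps}"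
  by (induction ps) (auto simp: list_all2_Cons2)

lemma replicate_pmf_conv_sequence_pmf: "replicate_pmf m p = sequence_pmf (replicate m p)"
  by (induction m) auto

text \<open>For mixtures whose outcome reveals the mixing variable: the number of children, the
  label of a root, or the order in which neighbours were visited.\<close>

lemma pmf_bind_unique:
  assumes "\<And>z'. z' \<noteq> z \<Longrightarrow> pmf (f z') x = 0"
  shows "pmf (bind_pmf p f) x = pmf p z * pmf (f z) x"
proof -
  have eq: "pmf (f z') x = indicator {z} z' * pmf (f z) x" for z'
    using assms by (cases "z' = z") auto
  have "pmf (bind_pmf p f) x = measure_pmf.expectation p (\<lambda>z'. indicator {z} z' * pmf (f z) x)"
    unfolding pmf_bind by (intro Bochner_Integration.integral_cong refl eq)
  then show ?thesis
    by (simp add: measure_pmf_single)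
qed

lemma gw_tree_Suc:
  "gw_tree q (Suc r) = bind_pmf q (\<lambda>m. map_pmf (Node ()) (sequence_pmf (replicate m (gw_tree q r))))"
  by (simp add: map_pmf_def replicate_pmf_conv_sequence_pmf)

lemma inj_Node: "inj (Node x)"
  by (auto simp: inj_def)

text \<open>A node at depth less than \<open>r\<close> with \<open>m\<close> children contributes
  the Poisson factor \<open>exp (-d) * d ^ m / fact m\<close>. The numbers of children add up to the
  number of edges, and the factorials make up \<open>weight\<close>. Childless nodes at these depths
  still contribute \<open>exp (-d)\<close>.\<close>

lemma pmf_gw_tree:
  assumes "d > 0"
  shows "height_le r t \<Longrightarrow> pmf (gw_tree (poisson_pmf d) r) t =
    exp (-d) ^ length (inner_nodes r t) * d ^ length (edges t) * weight t"
proof (induction r t rule: height_le.induct)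
  case (1 x ts)
  then show ?case by simp
next
  case (2 r x ts)
  let ?q = "gw_tree (poisson_pmf d) r"
  have "pmf (gw_tree (poisson_pmf d) (Suc r)) (Node () ts) =
    pmf (poisson_pmf d) (length ts) * pmf (map_pmf (Node ()) (sequence_pmf (replicate (length ts) ?q))) (Node () ts)"
    unfolding gw_tree_Suc
  proof (rule pmf_bind_unique)
    fix m assume "m \<noteq> length ts"
    then have "Node () ts \<notin> set_pmf (map_pmf (Node ()) (sequence_pmf (replicate m ?q)))"
      by (auto simp: set_sequence_pmf dest!: list_all2_lengthD)
    then show "pmf (map_pmf (Node ()) (sequence_pmf (replicate m ?q))) (Node () ts) = 0"
      by (simp add: set_pmf_eq)
  qed
  also have "\<dots> = pmf (poisson_pmf d) (length ts) * prod_list (map (pmf ?q) ts)"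
  proof -
    have "map2 pmf (replicate (length ts) ?q) ts = map (pmf ?q) ts"
      by (simp add: map2_map_map[symmetric] zip_replicate1 comp_def)
    then show ?thesis
      by (simp add: pmf_map_inj'[OF inj_Node] pmf_sequence_pmf)
  qed
  also have "prod_list (map (pmf ?q) ts) =
    prod_list (map (\<lambda>t. exp (-d) ^ length (inner_nodes r t) * d ^ length (edges t) * weight t) ts)"
    using 2 by (intro arg_cong[where f = prod_list] map_cong) auto
  also have "\<dots> = exp (-d) ^ length (concat (map (inner_nodes r) ts)) *
    (d ^ length (concat (map edges ts)) * prod_list (map weight ts))"
    by (induction ts) (auto simp: power_add)
  also have "length (concat (map (\<lambda>t. ((), root t) # edges t) ts)) =
      length ts + length (concat (map edges ts))"
    by (induction ts) auto
  then have "pmf (poisson_pmf d) (length ts) * (exp (-d) ^ length (concat (map (inner_nodes r) ts)) *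
    (d ^ length (concat (map edges ts)) * prod_list (map weight ts))) =
    exp (-d) ^ length (inner_nodes (Suc r) (Node () ts)) * d ^ length (edges (Node () ts)) * weight (Node () ts)"
    using assms by (simp add: power_add)
  finally show ?case by simp
qed

lemma height_le_gw_tree: "t \<in> set_pmf (gw_tree q r) \<Longrightarrow> height_le r t"
proof (induction r arbitrary: t)
  case (Suc r)
  then obtain ts where "t = Node () ts" "set ts \<subseteq> set_pmf (gw_tree q r)"
    by (auto simp: set_replicate_pmf simp del: in_lists_conv_set)
  then show ?case
    using Suc.IH by auto
qed auto

abbreviation edge_prob :: "nat \<Rightarrow> real \<Rightarrow> nat \<Rightarrow> nat \<Rightarrow> real" where
  "edge_prob k \<eta> s s' \<equiv> pmf (broadcast_edge k \<eta> s) s'"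

lemma broadcast_from_Node:
  "broadcast_from k \<eta> s (Node x ts) = map_pmf (Node s) (sequence_pmf
     (map (\<lambda>t. bind_pmf (broadcast_edge k \<eta> s) (\<lambda>s'. broadcast_from k \<eta> s' t)) ts))"
  by simp

lemma set_broadcast_from:
  "\<tau> \<in> set_pmf (broadcast_from k \<eta> s t) \<Longrightarrow> shape \<tau> = t \<and> root \<tau> = s"
proof (induction t arbitrary: s \<tau>)
  case (Node x ts)
  then obtain ts' where \<tau>: "\<tau> = Node s ts'" and
    *: "list_all2 (\<lambda>\<tau>' t. \<exists>s'\<in>set_pmf (broadcast_edge k \<eta> s). \<tau>' \<in> set_pmf (broadcast_from k \<eta> s' t)) ts' ts"
    by (auto simp: set_sequence_pmf list_all2_map2)
  from * Node.IH have "map shape ts' = ts"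
    by (induction rule: list_all2_induct) auto
  then show ?case using \<tau> by simp
qed

lemma pmf_broadcast_from:
  "shape \<tau> = t \<Longrightarrow> pmf (broadcast_from k \<eta> (root \<tau>) t) \<tau> = (\<Prod>(x, y)\<leftarrow>edges \<tau>. edge_prob k \<eta> x y)"
proof (induction \<tau> arbitrary: t)
  case (Node s ts)
  have t: "t = Node () (map shape ts)"
    using Node.prems by auto
  have child: "pmf (bind_pmf (broadcast_edge k \<eta> s) (\<lambda>s'. broadcast_from k \<eta> s' (shape \<tau>))) \<tau> =
    edge_prob k \<eta> s (root \<tau>) * (\<Prod>(x, y)\<leftarrow>edges \<tau>. edge_prob k \<eta> x y)" if "\<tau> \<in> set ts" for \<tau>
  proof -
    have "pmf (bind_pmf (broadcast_edge k \<eta> s) (\<lambda>s'. broadcast_from k \<eta> s' (shape \<tau>))) \<tau> =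
      edge_prob k \<eta> s (root \<tau>) * pmf (broadcast_from k \<eta> (root \<tau>) (shape \<tau>)) \<tau>"
    proof (rule pmf_bind_unique)
      fix z assume "z \<noteq> root \<tau>"
      then show "pmf (broadcast_from k \<eta> z (shape \<tau>)) \<tau> = 0"
        using set_broadcast_from[of \<tau> k \<eta> z "shape \<tau>"] by (auto simp: set_pmf_eq)
    qed
    then show ?thesis
      using Node.IH[OF that refl] by simp
  qed
  have "pmf (broadcast_from k \<eta> s t) (Node s ts) = prod_list (map2 pmf
     (map (\<lambda>t. bind_pmf (broadcast_edge k \<eta> s) (\<lambda>s'. broadcast_from k \<eta> s' t)) (map shape ts)) ts)"
    unfolding t broadcast_from_Node pmf_map_inj'[OF inj_Node] by (rule pmf_sequence_pmf) simp
  also have "\<dots> = prod_list (map (\<lambda>\<tau>. edge_prob k \<eta> s (root \<tau>) *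
      (\<Prod>(x, y)\<leftarrow>edges \<tau>. edge_prob k \<eta> x y)) ts)"
    using child by (induction ts) auto
  also have "\<dots> = (\<Prod>(x, y)\<leftarrow>edges (Node s ts). edge_prob k \<eta> x y)"
    by (induction ts) auto
  finally show ?case by simp
qed

lemma set_broadcast_edge:
  assumes "s \<in> {1..k}" "0 \<le> \<eta>"
  shows "set_pmf (broadcast_edge k \<eta> s) \<subseteq> {1..k}"
proof (cases "k = 1")
  \<comment> \<open>With a single label there is no other one to choose from and
    \<open>pmf_of_set {}\<close> is unspecified, but then the label is kept with probability
    1.\<close>
  case True
  moreover have "bernoulli_pmf 1 = return_pmf True"
    by (rule pmf_eqI) (auto simp: indicator_def split: bool.splits)
  ultimately show ?thesis
    using assms by (auto simp: broadcast_edge_def bind_return_pmf)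
next
  case False
  then have "card ({1..k} - {s}) > 0"
    using assms by (simp add: card_Diff_singleton)
  then have "set_pmf (pmf_of_set ({1..k} - {s})) = {1..k} - {s}"
    unfolding card_gt_0_iff by (intro set_pmf_of_set) blast+
  then show ?thesis
    using assms(1) unfolding broadcast_edge_def by (force split: if_splits)
qed

lemma set_nodes_broadcast_from:
  assumes "0 \<le> \<eta>"
  shows "s \<in> {1..k} \<Longrightarrow> \<tau> \<in> set_pmf (broadcast_from k \<eta> s t) \<Longrightarrow> set (nodes \<tau>) \<subseteq> {1..k}"
proof (induction t arbitrary: s \<tau>)
  case (Node x ts)
  then obtain ts' where \<tau>: "\<tau> = Node s ts'" and
    *: "list_all2 (\<lambda>\<tau>' t. \<exists>s'\<in>set_pmf (broadcast_edge k \<eta> s). \<tau>' \<in> set_pmf (broadcast_from k \<eta> s' t)) ts' ts"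
    by (auto simp: set_sequence_pmf list_all2_map2)
  have "set (nodes t') \<subseteq> {1..k}" if t': "t' \<in> set ts'" for t'
  proof -
    obtain t s' where "t \<in> set ts" "s' \<in> set_pmf (broadcast_edge k \<eta> s)"
      "t' \<in> set_pmf (broadcast_from k \<eta> s' t)"
      using * t' by (fastforce simp: list_all2_conv_all_nth in_set_conv_nth)
    then show ?thesis
      using Node.IH set_broadcast_edge[OF Node.prems(1) assms] by blast
  qed
  then show ?case using \<tau> Node.prems by auto
qed

definition labelings :: "nat \<Rightarrow> unit rtree \<Rightarrow> nat rtree set" where
  "labelings k t = {\<tau>. shape \<tau> = t \<and> set (nodes \<tau>) \<subseteq> {1..k}}"

lemma finite_labelings: "finite (labelings k t)"
proof -
  have "finite {xs. set xs \<subseteq> {1..k} \<and> length xs = length (nodes t)}"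
    by (rule finite_lists_length_eq) auto
  moreover have "nodes ` labelings k t \<subseteq> {xs. set xs \<subseteq> {1..k} \<and> length xs = length (nodes t)}"
    by (auto simp: labelings_def nodes_map_rtree)
  ultimately have "finite (nodes ` labelings k t)"
    by (rule rev_finite_subset)
  moreover have "inj_on nodes (labelings k t)"
    using bij_betw_nodes[of t] by (auto simp: bij_betw_def labelings_def inj_on_def)
  ultimately show ?thesis
    by (rule finite_imageD)
qed

lemma set_broadcast:
  assumes "k \<ge> 1" "0 \<le> \<eta>"
  shows "set_pmf (broadcast k \<eta> t) \<subseteq> labelings k t"
  using assms set_broadcast_from set_nodes_broadcast_from
  by (fastforce simp: broadcast_def labelings_def)

lemma pmf_broadcast:
  assumes "k \<ge> 1" "\<tau> \<in> labelings k t"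
  shows "pmf (broadcast k \<eta> t) \<tau> = (\<Prod>(x, y)\<leftarrow>edges \<tau>. edge_prob k \<eta> x y) / real k"
proof -
  have "pmf (broadcast k \<eta> t) \<tau> =
    pmf (pmf_of_set {1..k}) (root \<tau>) * pmf (broadcast_from k \<eta> (root \<tau>) t) \<tau>"
    unfolding broadcast_def
  proof (rule pmf_bind_unique)
    fix z assume "z \<noteq> root \<tau>"
    then show "pmf (broadcast_from k \<eta> z t) \<tau> = 0"
      using set_broadcast_from[of \<tau> k \<eta> z t] by (auto simp: set_pmf_eq)
  qed
  moreover have "root \<tau> \<in> {1..k}"
    using assms(2) subsetD[OF _ root_in_nodes[of \<tau>], of "{1..k}"] by (auto simp: labelings_def)
  moreover have "shape \<tau> = t"
    using assms(2) by (auto simp: labelings_def)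
  ultimately show ?thesis
    using assms(1) by (simp add: pmf_broadcast_from)
qed

section \<open>Independent uniform labels and the density of the broadcast law\<close>

abbreviation uniform_labels :: "nat set \<Rightarrow> nat \<Rightarrow> (nat \<Rightarrow> nat) pmf" where
  "uniform_labels V k \<equiv> Pi_pmf V 0 (\<lambda>_. pmf_of_set {1..k})"

lemma set_uniform_labels:
  "finite V \<Longrightarrow> k \<ge> 1 \<Longrightarrow> set_pmf (uniform_labels V k) = PiE_dflt V 0 (\<lambda>_. {1..k})"
  by (subst set_Pi_pmf) (auto simp: comp_def)

lemma finite_set_uniform_labels [simp]:
  "finite V \<Longrightarrow> k \<ge> 1 \<Longrightarrow> finite (set_pmf (uniform_labels V k))"
  by (subst set_uniform_labels) (auto intro!: finite_PiE_dflt)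

lemma pmf_map_rtree_uniform_labels:
  assumes "finite V" "set (nodes T) \<subseteq> V" "distinct (nodes T)" "k \<ge> 1" "\<tau> \<in> labelings k (shape T)"
  shows "pmf (map_pmf (\<lambda>\<sigma>. map_rtree \<sigma> T) (uniform_labels V k)) \<tau> = 1 / real k ^ length (nodes T)"
proof -
  have [simp]: "shape \<tau> = shape T" and \<tau>: "set (nodes \<tau>) \<subseteq> {1..k}"
    using assms(5) by (auto simp: labelings_def)
  then have len: "length (nodes \<tau>) = length (nodes T)"
    by (metis length_map nodes_map_rtree)
  \<comment> \<open>\<open>g\<close> reads the required vertex labels off \<open>\<tau>\<close> by
    matching the two preorder lists; distinctness of the nodes of \<open>T\<close> makes this
    consistent.\<close>
  define g where "g = (\<lambda>x. the (map_of (zip (nodes T) (nodes \<tau>)) x))"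
  have g: "map g (nodes T) = nodes \<tau>"
    using len assms(3) by (auto simp: list_eq_iff_nth_eq g_def map_of_zip_nth)
  define B where "B = (\<lambda>x. if x \<in> set (nodes T) then {g x} else UNIV)"
  have eq: "map_rtree \<sigma> T = \<tau> \<longleftrightarrow> (\<forall>x\<in>set (nodes T). \<sigma> x = g x)" for \<sigma>
  proof -
    have "map_rtree \<sigma> T = \<tau> \<longleftrightarrow> nodes (map_rtree \<sigma> T) = nodes \<tau>"
      using tree_eqI[of "map_rtree \<sigma> T" \<tau>] by (auto simp: rtree.map_comp comp_def)
    also have "\<dots> \<longleftrightarrow> (\<forall>x\<in>set (nodes T). \<sigma> x = g x)"
      unfolding g[symmetric] by (simp add: nodes_map_rtree)
    finally show ?thesis .
  qed
  have "map_rtree \<sigma> T = \<tau> \<longleftrightarrow> \<sigma> \<in> Pi V B" for \<sigma>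
    unfolding eq using assms(2) by (auto simp: B_def Pi_def)
  then have "pmf (map_pmf (\<lambda>\<sigma>. map_rtree \<sigma> T) (uniform_labels V k)) \<tau> =
    measure_pmf.prob (uniform_labels V k) (Pi V B)"
    unfolding pmf_map vimage_def by simp
  also have "\<dots> = (\<Prod>x\<in>V. measure_pmf.prob (pmf_of_set {1..k}) (B x))"
    by (rule measure_Pi_pmf_Pi) fact
  also have "\<dots> = (\<Prod>x\<in>set (nodes T). measure_pmf.prob (pmf_of_set {1..k}) (B x))"
    using assms(1,2) by (intro prod.mono_neutral_right) (auto simp: B_def)
  also have "\<dots> = (\<Prod>x\<in>set (nodes T). 1 / real k)"
  proof (rule prod.cong)
    fix x assume x: "x \<in> set (nodes T)"
    then have "g x \<in> set (nodes \<tau>)"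
      by (metis g image_eqI list.set_map)
    then show "measure_pmf.prob (pmf_of_set {1..k}) (B x) = 1 / real k"
      using x assms(4) \<tau> by (auto simp: B_def measure_pmf_single pmf_of_set)
  qed simp
  also have "\<dots> = 1 / real k ^ length (nodes T)"
    by (simp add: assms(3) distinct_card power_one_over)
  finally show ?thesis .
qed

lemma map_rtree_labelings:
  assumes "finite V" "set (nodes T) \<subseteq> V" "k \<ge> 1" "\<sigma> \<in> set_pmf (uniform_labels V k)"
  shows "map_rtree \<sigma> T \<in> labelings k (shape T)"
  using assms(2,4) unfolding set_uniform_labels[OF assms(1,3)]
  by (auto simp: PiE_dflt_def labelings_def rtree.map_comp comp_def nodes_map_rtree)

lemma prod_list_const_mult:
  "prod_list (map (\<lambda>x. c * f x) xs) = (c :: 'a :: comm_monoid_mult) ^ length xs * prod_list (map f xs)"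
  by (induction xs) (auto simp: ac_simps)

text \<open>A change of measure: the product is the density of the broadcast law with respect to
  independent uniform labels. Distinct nodes are what makes the labels along \<open>T\<close>
  independent.\<close>

lemma expectation_broadcast_conv_uniform_labels:
  fixes F :: "nat rtree \<Rightarrow> real"
  assumes "finite V" "set (nodes T) \<subseteq> V" "distinct (nodes T)" "k \<ge> 1" "0 \<le> \<eta>"
  shows "measure_pmf.expectation (uniform_labels V k)
      (\<lambda>\<sigma>. (\<Prod>(x, y)\<leftarrow>edges T. real k * edge_prob k \<eta> (\<sigma> x) (\<sigma> y)) * F (map_rtree \<sigma> T)) =
    measure_pmf.expectation (broadcast k \<eta> (shape T)) F"
proof -
  define W where "W = (\<lambda>\<tau>. \<Prod>(x, y)\<leftarrow>edges \<tau>. real k * edge_prob k \<eta> x y)"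
  let ?M = "map_pmf (\<lambda>\<sigma>. map_rtree \<sigma> T) (uniform_labels V k)"
  let ?L = "labelings k (shape T)"
  have W: "(\<Prod>(x, y)\<leftarrow>edges T. real k * edge_prob k \<eta> (\<sigma> x) (\<sigma> y)) = W (map_rtree \<sigma> T)" for \<sigma>
    by (simp add: W_def edges_map_rtree comp_def case_prod_unfold)
  have "measure_pmf.expectation (uniform_labels V k) (\<lambda>\<sigma>. W (map_rtree \<sigma> T) * F (map_rtree \<sigma> T)) =
    measure_pmf.expectation ?M (\<lambda>\<tau>. W \<tau> * F \<tau>)"
    by simp
  also have "\<dots> = (\<Sum>\<tau>\<in>?L. W \<tau> * F \<tau> * pmf ?M \<tau>)"
    using map_rtree_labelings[OF assms(1,2,4)]
    by (intro integral_measure_pmf_real[OF finite_labelings]) auto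
  also have "\<dots> = (\<Sum>\<tau>\<in>?L. F \<tau> * pmf (broadcast k \<eta> (shape T)) \<tau>)"
  proof (rule sum.cong)
    fix \<tau> assume \<tau>: "\<tau> \<in> ?L"
    then have "length (edges \<tau>) = length (edges T)"
      by (auto simp: labelings_def) (metis edges_map_rtree length_map)
    moreover have "W \<tau> = real k ^ length (edges \<tau>) * (\<Prod>(x, y)\<leftarrow>edges \<tau>. edge_prob k \<eta> x y)"
      unfolding W_def by (subst prod_list_const_mult[symmetric]) (simp add: case_prod_unfold)
    \<comment> \<open>A tree has one more node than edges, so the factors \<open>k\<close> cancel
      all but one factor \<open>1 / k\<close>, which is the uniform law of the root label.\<close>
    ultimately show "W \<tau> * F \<tau> * pmf ?M \<tau> = F \<tau> * pmf (broadcast k \<eta> (shape T)) \<tau>"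
      using assms(4) pmf_map_rtree_uniform_labels[OF assms(1-4) \<tau>] pmf_broadcast[OF assms(4) \<tau>, of \<eta>]
      by (simp add: length_nodes)
  qed simp
  also have "\<dots> = measure_pmf.expectation (broadcast k \<eta> (shape T)) F"
    using set_broadcast[OF assms(4,5)]
    by (intro integral_measure_pmf_real[OF finite_labelings, symmetric]) auto
  finally show ?thesis
    unfolding W .
qed

section \<open>Exploring a graph\<close>

text \<open>The random exploration behind the bound on the total weight of explored trees.
  \<open>P\<close> holds the parent, and is empty at the start. Only the parent is avoided, so
  cycles may lead to repeated nodes; the argument uses only those outcomes whose nodes are
  distinct.\<close>

primrec explore :: "nat \<Rightarrow> nat set set \<Rightarrow> nat set \<Rightarrow> nat \<Rightarrow> nat rtree pmf" where
  "explore 0 G P x = return_pmf (Node x [])"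
| "explore (Suc r) G P x =
     do {
       ys \<leftarrow> pmf_of_set (permutations_of_set ({y. {x, y} \<in> G} - P));
       map_pmf (Node x) (sequence_pmf (map (explore r G {x}) ys))
     }"

lemma root_explore: "T \<in> set_pmf (explore r G P x) \<Longrightarrow> root T = x"
  by (cases r) auto

lemma set_inner_nodes_subset: "set (inner_nodes r T) \<subseteq> set (nodes T)"
  by (induction r T rule: inner_nodes.induct) auto

lemma distinct_concat_nodes:
  "distinct (concat (map nodes ts)) \<Longrightarrow> distinct (map root ts)"
proof (induction ts)
  case (Cons t ts)
  have "root t \<notin> root ` set ts"
  proof
    assume "root t \<in> root ` set ts"
    then obtain t' where "t' \<in> set ts" "root t = root t'"
      by auto
    then show False
      using Cons.prems root_in_nodes[of t] root_in_nodes[of t'] by (auto simp del: root_in_nodes)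
  qed
  then show ?case
    using Cons by auto
qed auto

lemma distinct_concat_nodes_unique:
  "distinct (concat (map nodes ts)) \<Longrightarrow> t \<in> set ts \<Longrightarrow> t' \<in> set ts \<Longrightarrow>
    z \<in> set (nodes t) \<Longrightarrow> z \<in> set (nodes t') \<Longrightarrow> t = t'"
  by (induction ts) auto

lemma distinct_concat_nodes_child:
  "distinct (concat (map nodes ts)) \<Longrightarrow> t \<in> set ts \<Longrightarrow> distinct (nodes t)"
  by (induction ts) auto

text \<open>At the inner nodes the graph agrees with the tree, up to the edges from the root to
  \<open>P\<close>. So the neighbours met at an inner node are precisely its children, and only
  their order is left to chance: \<open>m\<close> children come in the right order with probability
  \<open>1 / fact m\<close>.\<close>

lemma pmf_explore:
  assumes "finite G" and "\<And>e. e \<in> G \<Longrightarrow> finite e"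
  shows "height_le r T \<Longrightarrow> distinct (nodes T) \<Longrightarrow> P \<inter> set (nodes T) = {} \<Longrightarrow>
    (\<And>x y. x \<in> set (inner_nodes r T) \<Longrightarrow>
      {x, y} \<in> G \<longleftrightarrow> (x, y) \<in> set (edges T) \<or> (y, x) \<in> set (edges T) \<or> x = root T \<and> y \<in> P) \<Longrightarrow>
    pmf (explore r G P (root T)) T = weight T"
proof (induction r T arbitrary: P rule: height_le.induct)
  case (1 x ts)
  then show ?case by simp
next
  case (2 r x ts)
  have dist: "distinct (concat (map nodes ts))" and x: "x \<notin> set (concat (map nodes ts))"
    using 2(3) by auto
  have inner_in: "z \<in> set (concat (map nodes ts))" if "t \<in> set ts" "z \<in> set (nodes t)" for z t
    using that by auto
  have root_in: "root t \<in> set (concat (map nodes ts))" if "t \<in> set ts" for t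
    using that inner_in root_in_nodes by blast
  have edge_in: "y \<in> set (concat (map nodes ts)) \<and> z \<in> set (concat (map nodes ts))"
    if "t \<in> set ts" "(y, z) \<in> set (edges t)" for t y z
    using that inner_in edges_subset by blast
  have edges: "(y, z) \<in> set (edges (Node x ts)) \<longleftrightarrow>
      (y = x \<and> z \<in> root ` set ts) \<or> (\<exists>t\<in>set ts. (y, z) \<in> set (edges t))" for y z
    by auto
  define S where "S = {y. {x, y} \<in> G} - P"
  have S: "S = set (map root ts)"
  proof -
    have "{x, y} \<in> G \<longleftrightarrow> y \<in> root ` set ts \<or> y \<in> P" for y
      using 2(5)[of x y] x edge_in unfolding edges by auto blast+
    moreover have "root ` set ts \<inter> P = {}"
      using 2(4) root_in by auto
    ultimately show ?thesis
      by (auto simp: S_def)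
  qed
  have perm: "map root ts \<in> permutations_of_set S"
    using distinct_concat_nodes[OF dist] S by (auto simp: permutations_of_set_def)
  have finS: "finite S"
    by (simp add: S)
  have child: "pmf (explore r G {x} (root t)) t = weight t" if t: "t \<in> set ts" for t
  proof (rule 2(1)[OF t])
    show "height_le r t"
      using 2(2) t by simp
    show "distinct (nodes t)"
      using distinct_concat_nodes_child[OF dist t] .
    show "{x} \<inter> set (nodes t) = {}"
      using x t by auto
    fix z y assume z: "z \<in> set (inner_nodes r t)"
    then have zt: "z \<in> set (nodes t)"
      by (rule subsetD[OF set_inner_nodes_subset])
    then have zx: "z \<noteq> x"
      using x t by auto
    have only: "t' = t" if "t' \<in> set ts" "z \<in> set (nodes t')" for t'
      using distinct_concat_nodes_unique[OF dist] that t zt by blast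
    have e1: "(z, y) \<in> set (edges (Node x ts)) \<longleftrightarrow> (z, y) \<in> set (edges t)"
      unfolding edges using zx only t edges_subset by blast
    \<comment> \<open>The only edge entering the subtree comes from \<open>x\<close> and ends at the
      root of \<open>t\<close>; the new excluded set \<open>{x}\<close> accounts for it.\<close>
    have e2: "(y, z) \<in> set (edges (Node x ts)) \<longleftrightarrow> (y, z) \<in> set (edges t) \<or> y = x \<and> z = root t"
      unfolding edges using only t edges_subset root_in_nodes by blast
    have "z \<in> set (inner_nodes (Suc r) (Node x ts))"
      using z t by auto
    from 2(5)[OF this, of y]
    show "{z, y} \<in> G \<longleftrightarrow> (z, y) \<in> set (edges t) \<or> (y, z) \<in> set (edges t) \<or> z = root t \<and> y \<in> {x}"
      unfolding e1 e2 using zx by auto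
  qed
  have "pmf (explore (Suc r) G P x) (Node x ts) = pmf (pmf_of_set (permutations_of_set S)) (map root ts) *
    pmf (map_pmf (Node x) (sequence_pmf (map (explore r G {x}) (map root ts)))) (Node x ts)"
    unfolding explore.simps S_def[symmetric]
  proof (rule pmf_bind_unique)
    \<comment> \<open>The order \<open>ys\<close> can be recovered from the roots of the sampled
      subtrees, so no other order can produce \<open>ts\<close>.\<close>
    fix ys assume ys: "ys \<noteq> map root ts"
    have "Node x ts \<notin> set_pmf (map_pmf (Node x) (sequence_pmf (map (explore r G {x}) ys)))"
    proof
      assume "Node x ts \<in> set_pmf (map_pmf (Node x) (sequence_pmf (map (explore r G {x}) ys)))"
      then have "list_all2 (\<lambda>t y. t \<in> set_pmf (explore r G {x} y)) ts ys"
        by (auto simp: set_sequence_pmf list_all2_map2)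
      then have "ys = map root ts"
        by (auto simp: list_all2_conv_all_nth list_eq_iff_nth_eq root_explore)
      with ys show False by simp
    qed
    then show "pmf (map_pmf (Node x) (sequence_pmf (map (explore r G {x}) ys))) (Node x ts) = 0"
      by (simp add: set_pmf_eq)
  qed
  also have "pmf (pmf_of_set (permutations_of_set S)) (map root ts) = 1 / fact (length ts)"
  proof -
    have "card S = length ts"
      using distinct_card[OF distinct_concat_nodes[OF dist]] S by simp
    then show ?thesis
      using perm finS by (subst pmf_of_set) (auto simp: permutations_of_set_empty_iff)
  qed
  also have "pmf (map_pmf (Node x) (sequence_pmf (map (explore r G {x}) (map root ts)))) (Node x ts) =
    prod_list (map2 pmf (map (explore r G {x}) (map root ts)) ts)"
    unfolding pmf_map_inj'[OF inj_Node] by (rule pmf_sequence_pmf) simp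
  also have "map2 pmf (map (explore r G {x}) (map root ts)) ts = map weight ts"
    using child by (induction ts) auto
  finally show ?case by simp
qed

section \<open>Trees embedded in a graph\<close>

abbreviation edge_set :: "'a rtree \<Rightarrow> 'a set set" where
  "edge_set T \<equiv> (\<lambda>(x, y). {x, y}) ` set (edges T)"

text \<open>Equality excludes further edges at inner vertices, but leaves the edges among the
  vertices of generation \<open>r\<close>, and from these to the outside, unconstrained.\<close>

definition explored :: "nat \<Rightarrow> nat set set \<Rightarrow> nat rtree \<Rightarrow> bool" where
  "explored r G T \<longleftrightarrow> {e \<in> G. e \<inter> set (inner_nodes r T) \<noteq> {}} = edge_set T"

definition embeddings :: "nat \<Rightarrow> nat \<Rightarrow> unit rtree \<Rightarrow> nat rtree set" where
  "embeddings n v t = {T. shape T = t \<and> distinct (nodes T) \<and> set (nodes T) \<subseteq> {1..n} \<and> root T = v}"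

lemma finite_pairs: "finite (pairs n)"
  by (rule finite_subset[of _ "Pow {1..n}"]) (auto simp: pairs_def)

text \<open>
  The weights of the trees explored in \<open>G\<close> are the probabilities of disjoint outcomes of a single
  exploration that visits the neighbours of each vertex in random order.
\<close>

lemma sum_weight_explored_le_1:
  assumes "G \<subseteq> pairs n" "finite \<T>"
    and "\<And>T. T \<in> \<T> \<Longrightarrow> height_le r T \<and> distinct (nodes T) \<and> root T = v \<and> explored r G T"
  shows "(\<Sum>T\<in>\<T>. weight T) \<le> 1"
proof -
  have "(\<Sum>T\<in>\<T>. weight T) = (\<Sum>T\<in>\<T>. pmf (explore r G {} v) T)"
  proof (rule sum.cong)
    fix T assume T: "T \<in> \<T>"
    have "pmf (explore r G {} (root T)) T = weight T"
    proof (rule pmf_explore)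
      show "finite G"
        using assms(1) finite_pairs by (rule finite_subset)
      show "finite e" if "e \<in> G" for e
        using that assms(1) by (auto simp: pairs_def intro: finite_subset)
      fix x y assume x: "x \<in> set (inner_nodes r T)"
      have "{x, y} \<in> G \<longleftrightarrow> {x, y} \<in> {e \<in> G. e \<inter> set (inner_nodes r T) \<noteq> {}}"
        using x by auto
      also have "\<dots> \<longleftrightarrow> {x, y} \<in> edge_set T"
        using assms(3)[OF T] by (simp add: explored_def)
      also have "\<dots> \<longleftrightarrow> (x, y) \<in> set (edges T) \<or> (y, x) \<in> set (edges T)"
        by (force simp: doubleton_eq_iff)
      finally show "{x, y} \<in> G \<longleftrightarrow> (x, y) \<in> set (edges T) \<or> (y, x) \<in> set (edges T) \<or> x = root T \<and> y \<in> {}"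
        by simp
    qed (use assms(3)[OF T] in auto)
    then show "weight T = pmf (explore r G {} v) T"
      using assms(3)[OF T] by simp
  qed simp
  also have "\<dots> = measure_pmf.prob (explore r G {} v) \<T>"
    by (rule measure_measure_pmf_finite[symmetric]) fact
  also have "\<dots> \<le> 1"
    by simp
  finally show ?thesis .
qed

lemma bij_betw_embeddings:
  assumes "v \<in> {1..n}"
  shows "bij_betw (\<lambda>T. tl (nodes T)) (embeddings n v t)
    {xs. length xs = length (edges t) \<and> distinct xs \<and> set xs \<subseteq> {1..n} - {v}}"
proof (rule bij_betwI')
  have nodes: "nodes T = v # tl (nodes T)" if "T \<in> embeddings n v t" for T
    using that by (cases T) (auto simp: embeddings_def)
  fix T assume T: "T \<in> embeddings n v t"
  {
    fix T' assume T': "T' \<in> embeddings n v t"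
    show "tl (nodes T) = tl (nodes T') \<longleftrightarrow> T = T'"
    proof
      assume "tl (nodes T) = tl (nodes T')"
      then have "nodes T = nodes T'"
        using nodes[OF T] nodes[OF T'] by simp
      moreover have "shape T = shape T'"
        using T T' by (auto simp: embeddings_def)
      ultimately show "T = T'"
        by (rule tree_eqI[rotated])
    qed simp
  }
  have "length (nodes T) = Suc (length (edges t))"
    using T length_nodes[of T] by (auto simp: embeddings_def edges_map_rtree)
  moreover have "distinct (v # tl (nodes T))" "set (v # tl (nodes T)) \<subseteq> {1..n}"
    using T nodes[OF T] by (auto simp: embeddings_def)
  ultimately show "tl (nodes T) \<in> {xs. length xs = length (edges t) \<and> distinct xs \<and> set xs \<subseteq> {1..n} - {v}}"
    by auto
next
  fix xs assume xs: "xs \<in> {xs. length xs = length (edges t) \<and> distinct xs \<and> set xs \<subseteq> {1..n} - {v}}"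
  then have "v # xs \<in> nodes ` {T. shape T = t}"
    unfolding bij_betw_imp_surj_on[OF bij_betw_nodes] by (simp add: length_nodes)
  then obtain T where T: "shape T = t" "nodes T = v # xs"
    by force
  moreover have "root T = v"
    using hd_nodes[of T] T by simp
  ultimately show "\<exists>T\<in>embeddings n v t. xs = tl (nodes T)"
    using xs assms by (intro bexI[of _ T]) (auto simp: embeddings_def)
qed

text \<open>With the root pinned at \<open>v\<close>, the count is the falling factorial from
  \<open>n - 1\<close> down to \<open>n - L\<close>, where \<open>L\<close> is the number of edges.
  The shape has \<open>L + 1\<close> nodes, so each factor lies between \<open>n - (L + 1)\<close>
  and \<open>n\<close>. For a fixed shape both bounds are asymptotic to
  \<open>n ^ L\<close>.\<close>

lemma card_embeddings:
  assumes "v \<in> {1..n}" "length (nodes t) \<le> n"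
  shows "card (embeddings n v t) \<le> n ^ length (edges t)"
    and "card (embeddings n v t) \<ge> (n - length (nodes t)) ^ length (edges t)"
proof -
  let ?m = "length (edges t)"
  have "card (embeddings n v t) =
    card {xs. length xs = ?m \<and> distinct xs \<and> set xs \<subseteq> {1..n} - {v}}"
    by (rule bij_betw_same_card[OF bij_betw_embeddings]) fact
  also have "\<dots> = \<Prod>{card ({1..n} - {v}) - ?m + 1..card ({1..n} - {v})}"
    using assms by (intro card_lists_distinct_length_eq) (auto simp: length_nodes)
  also have "card ({1..n} - {v}) = n - 1"
    using assms by (simp add: card_Diff_singleton)
  finally have *: "card (embeddings n v t) = \<Prod>{n - 1 - ?m + 1..n - 1}" .
  have card: "card {n - 1 - ?m + 1..n - 1} = ?m"
    using assms by (simp add: length_nodes)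
  have "(\<Prod>i\<in>{n - 1 - ?m + 1..n - 1}. i) \<le> (\<Prod>i\<in>{n - 1 - ?m + 1..n - 1}. n)"
    by (intro prod_mono) auto
  then show "card (embeddings n v t) \<le> n ^ length (edges t)"
    unfolding * using card by simp
  have "(\<Prod>i\<in>{n - 1 - ?m + 1..n - 1}. i) \<ge> (\<Prod>i\<in>{n - 1 - ?m + 1..n - 1}. n - length (nodes t))"
    by (intro prod_mono) (auto simp: length_nodes)
  then show "card (embeddings n v t) \<ge> (n - length (nodes t)) ^ length (edges t)"
    unfolding * using card by simp
qed

lemma finite_embeddings: "finite (embeddings n v t)"
proof (cases "v \<in> {1..n}")
  case True
  have "finite {xs. set xs \<subseteq> {1..n} \<and> length xs = length (edges t)}"
    by (rule finite_lists_length_eq) auto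
  then have "finite {xs. length xs = length (edges t) \<and> distinct xs \<and> set xs \<subseteq> {1..n} - {v}}"
    by (rule rev_finite_subset) auto
  then show ?thesis
    using bij_betw_finite[OF bij_betw_embeddings[OF True]] by simp
next
  case False
  then have "embeddings n v t = {}"
    using root_in_nodes unfolding embeddings_def by blast
  then show ?thesis by simp
qed

section \<open>Posteriors and concentration\<close>

lemma expectation_bind_finite:
  fixes h :: "'b \<Rightarrow> real"
  assumes "finite (set_pmf p)" "\<And>x. x \<in> set_pmf p \<Longrightarrow> finite (set_pmf (f x))"
  shows "measure_pmf.expectation (bind_pmf p f) h =
    measure_pmf.expectation p (\<lambda>x. measure_pmf.expectation (f x) h)"
proof -
  have "measure_pmf.expectation (bind_pmf p f) h =
      (\<Sum>x\<in>set_pmf p. pmf p x *\<^sub>R measure_pmf.expectation (f x) h)"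
    by (rule pmf_expectation_bind) (use assms in auto)
  also have "\<dots> = measure_pmf.expectation p (\<lambda>x. measure_pmf.expectation (f x) h)"
    by (subst integral_measure_pmf[OF assms(1)]) auto
  finally show ?thesis .
qed

lemma abs_expectation_le:
  fixes f g :: "'a \<Rightarrow> real"
  assumes "finite (set_pmf M)" "\<And>x. x \<in> set_pmf M \<Longrightarrow> \<bar>f x\<bar> \<le> g x"
  shows "\<bar>measure_pmf.expectation M f\<bar> \<le> measure_pmf.expectation M g"
  using assms(2)
  by (auto simp: integral_measure_pmf_real[OF assms(1)] abs_mult
    intro!: order.trans[OF sum_abs] sum_mono mult_right_mono)

lemma expectation_mono_finite:
  fixes f g :: "'a \<Rightarrow> real"
  assumes "finite (set_pmf M)" "\<And>x. x \<in> set_pmf M \<Longrightarrow> f x \<le> g x"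
  shows "measure_pmf.expectation M f \<le> measure_pmf.expectation M g"
  using assms(2)
  by (auto simp: integral_measure_pmf_real[OF assms(1)] intro!: sum_mono mult_right_mono)

text \<open>The averaging property of conditional expectation. Both sides are summed over the fibres
  of \<open>Y\<close>, on each of which the posterior and \<open>f\<close> are constant.\<close>

lemma expectation_posterior:
  fixes f :: "'o \<Rightarrow> real"
  assumes fin: "finite (set_pmf M)"
  shows "measure_pmf.expectation M (\<lambda>\<omega>. posterior M A Y \<omega> * f (Y \<omega>)) =
    measure_pmf.expectation M (\<lambda>\<omega>. of_bool (A \<omega>) * f (Y \<omega>))"
proof -
  let ?S = "set_pmf M"
  define D where "D = (\<lambda>y. \<Sum>\<omega>\<in>{\<omega>\<in>?S. Y \<omega> = y}. pmf M \<omega>)"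
  define N where "N = (\<lambda>y. \<Sum>\<omega>\<in>{\<omega>\<in>?S. Y \<omega> = y}. of_bool (A \<omega>) * pmf M \<omega>)"
  have post: "posterior M A Y \<omega> = N (Y \<omega>) / D (Y \<omega>)" for \<omega>
  proof -
    have prob: "measure_pmf.prob M B = (\<Sum>\<omega>\<in>?S \<inter> B. pmf M \<omega>)" for B
      using measure_Int_set_pmf[of M B] fin by (simp add: Int_commute measure_measure_pmf_finite)
    have "N (Y \<omega>) = (\<Sum>\<omega>'\<in>?S \<inter> {\<omega>'. A \<omega>' \<and> Y \<omega>' = Y \<omega>}. pmf M \<omega>')"
      unfolding N_def using fin by (intro sum.mono_neutral_cong_right) auto
    moreover have "D (Y \<omega>) = (\<Sum>\<omega>'\<in>?S \<inter> {\<omega>'. Y \<omega>' = Y \<omega>}. pmf M \<omega>')"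
      unfolding D_def by (intro sum.cong) auto
    ultimately show ?thesis
      by (simp add: posterior_def cond_prob_def prob)
  qed
  \<comment> \<open>The quotient \<open>N y / D y\<close> is meaningful only for observations of
    positive probability, and every outcome in the support yields one.\<close>
  have "D y > 0" if "y \<in> Y ` ?S" for y
    unfolding D_def using that fin by (intro sum_pos) (auto simp: pmf_positive)
  then have *: "N y / D y * D y = N y" if "y \<in> Y ` ?S" for y
    using that by force
  have "measure_pmf.expectation M (\<lambda>\<omega>. posterior M A Y \<omega> * f (Y \<omega>)) =
    (\<Sum>\<omega>\<in>?S. N (Y \<omega>) / D (Y \<omega>) * f (Y \<omega>) * pmf M \<omega>)"
    unfolding post by (rule integral_measure_pmf_real[OF fin]) auto
  also have "\<dots> = (\<Sum>y\<in>Y ` ?S. \<Sum>\<omega>\<in>{\<omega>\<in>?S. Y \<omega> = y}. N (Y \<omega>) / D (Y \<omega>) * f (Y \<omega>) * pmf M \<omega>)"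
    by (rule sum.image_gen[OF fin])
  also have "\<dots> = (\<Sum>y\<in>Y ` ?S. f y * (N y / D y * D y))"
  proof (intro sum.cong refl)
    fix y
    have "(\<Sum>\<omega>\<in>{\<omega>\<in>?S. Y \<omega> = y}. N (Y \<omega>) / D (Y \<omega>) * f (Y \<omega>) * pmf M \<omega>) =
        (\<Sum>\<omega>\<in>{\<omega>\<in>?S. Y \<omega> = y}. f y * (N y / D y) * pmf M \<omega>)"
      by (intro sum.cong) auto
    also have "\<dots> = f y * (N y / D y) * D y"
      unfolding D_def by (rule sum_distrib_left[symmetric])
    finally show "(\<Sum>\<omega>\<in>{\<omega>\<in>?S. Y \<omega> = y}. N (Y \<omega>) / D (Y \<omega>) * f (Y \<omega>) * pmf M \<omega>) =
        f y * (N y / D y * D y)"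
      by simp
  qed
  also have "\<dots> = (\<Sum>y\<in>Y ` ?S. f y * N y)"
    using * by (intro sum.cong refl) simp
  also have "\<dots> = (\<Sum>y\<in>Y ` ?S. \<Sum>\<omega>\<in>{\<omega>\<in>?S. Y \<omega> = y}. of_bool (A \<omega>) * f (Y \<omega>) * pmf M \<omega>)"
    unfolding N_def by (intro sum.cong refl) (auto simp: sum_distrib_left mult_ac)
  also have "\<dots> = (\<Sum>\<omega>\<in>?S. of_bool (A \<omega>) * f (Y \<omega>) * pmf M \<omega>)"
    by (rule sum.image_gen[OF fin, symmetric])
  also have "\<dots> = measure_pmf.expectation M (\<lambda>\<omega>. of_bool (A \<omega>) * f (Y \<omega>))"
    by (rule integral_measure_pmf_real[OF fin, symmetric]) auto
  finally show ?thesis .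
qed

lemma expectation_posterior_diff:
  fixes f :: "'o \<Rightarrow> real"
  assumes fin: "finite (set_pmf M)"
  shows "measure_pmf.expectation M (\<lambda>\<omega>. (posterior M A Y \<omega> - c) * f (Y \<omega>)) =
    measure_pmf.expectation M (\<lambda>\<omega>. (of_bool (A \<omega>) - c) * f (Y \<omega>))"
  using expectation_posterior[OF fin, of A Y f]
  by (simp add: left_diff_distrib integrable_measure_pmf_finite[OF fin])

text \<open>The easy half of the duality. It is used for the broadcast process, whereas the converse
  half is used for the block model.\<close>

lemma expectation_diff_le_posterior:
  fixes f :: "'o \<Rightarrow> real"
  assumes fin: "finite (set_pmf M)" and "\<And>y. \<bar>f y\<bar> \<le> 1"
  shows "\<bar>measure_pmf.expectation M (\<lambda>\<omega>. (of_bool (A \<omega>) - c) * f (Y \<omega>))\<bar> \<le>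
    measure_pmf.expectation M (\<lambda>\<omega>. \<bar>posterior M A Y \<omega> - c\<bar>)"
  unfolding expectation_posterior_diff[OF fin, symmetric]
  using assms(2) by (intro abs_expectation_le fin) (auto simp: abs_mult intro: mult_left_le)

text \<open>The extremal test function is the sign of the difference.\<close>

lemma expectation_posterior_le:
  assumes fin: "finite (set_pmf M)"
    and "\<And>f :: 'o \<Rightarrow> real. (\<And>y. \<bar>f y\<bar> \<le> 1) \<Longrightarrow>
      measure_pmf.expectation M (\<lambda>\<omega>. (of_bool (A \<omega>) - c) * f (Y \<omega>)) \<le> \<delta>"
  shows "measure_pmf.expectation M (\<lambda>\<omega>. \<bar>posterior M A Y \<omega> - c\<bar>) \<le> \<delta>"
proof -
  \<comment> \<open>Written through \<open>cond_prob\<close> with a free observation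
    \<open>y\<close>, the sign is visibly a function of the observation alone.\<close>
  define f where "f = (\<lambda>y. sgn (cond_prob (measure_pmf M) A (\<lambda>\<omega>'. Y \<omega>' = y) - c))"
  have "\<bar>posterior M A Y \<omega> - c\<bar> = (posterior M A Y \<omega> - c) * f (Y \<omega>)" for \<omega>
    by (simp add: f_def posterior_def abs_sgn mult.commute)
  then have "measure_pmf.expectation M (\<lambda>\<omega>. \<bar>posterior M A Y \<omega> - c\<bar>) =
      measure_pmf.expectation M (\<lambda>\<omega>. (of_bool (A \<omega>) - c) * f (Y \<omega>))"
    by (simp add: expectation_posterior_diff[OF fin])
  also have "\<dots> \<le> \<delta>"
    by (rule assms(2)) (auto simp: f_def abs_sgn_eq)
  finally show ?thesis .
qed

lemma prob_gt_le_expectation: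
  fixes X :: "'a \<Rightarrow> real"
  assumes fin: "finite (set_pmf M)" and "\<epsilon> > 0"
  shows "measure_pmf.prob M {\<omega>. \<bar>X \<omega>\<bar> > \<epsilon>} \<le> measure_pmf.expectation M (\<lambda>\<omega>. \<bar>X \<omega>\<bar>) / \<epsilon>"
proof -
  have "measure_pmf.prob M {\<omega>. \<bar>X \<omega>\<bar> > \<epsilon>} = measure_pmf.expectation M (indicator {\<omega>. \<bar>X \<omega>\<bar> > \<epsilon>})"
    by simp
  also have "\<dots> \<le> measure_pmf.expectation M (\<lambda>\<omega>. \<bar>X \<omega>\<bar> / \<epsilon>)"
    using assms(2) by (intro expectation_mono_finite fin) (auto simp: indicator_def divide_simps)
  finally show ?thesis by simp
qed

lemma expectation_abs_le_sqrt:
  fixes X :: "'a \<Rightarrow> real"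
  assumes fin: "finite (set_pmf M)"
  shows "measure_pmf.expectation M (\<lambda>\<omega>. \<bar>X \<omega>\<bar>) \<le> sqrt (measure_pmf.expectation M (\<lambda>\<omega>. (X \<omega>)\<^sup>2))"
proof -
  have "0 \<le> measure_pmf.variance M (\<lambda>\<omega>. \<bar>X \<omega>\<bar>)"
    by (rule measure_pmf.variance_positive)
  also have "\<dots> = measure_pmf.expectation M (\<lambda>\<omega>. \<bar>X \<omega>\<bar>\<^sup>2) - (measure_pmf.expectation M (\<lambda>\<omega>. \<bar>X \<omega>\<bar>))\<^sup>2"
    by (rule measure_pmf.variance_eq) (auto intro: integrable_measure_pmf_finite[OF fin])
  finally show ?thesis
    by (intro real_le_rsqrt) simp
qed

section \<open>Concentration of the probability of missing edges\<close>

lemma exp_minus_le: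
  assumes "(y::real) \<ge> 0"
  shows "exp (-y) \<le> 1 - y + y\<^sup>2"
proof -
  \<comment> \<open>The claim amounts to \<open>1 \<le> (1 - y + y^2) * exp y\<close>. Since
    \<open>1 + y \<le> exp y\<close>, it suffices to have it with \<open>1 + y\<close> in place of
    \<open>exp y\<close>.\<close>
  have "(1 - y + y\<^sup>2) * (1 + y) = 1 + y ^ 3"
    by (simp add: algebra_simps power2_eq_square power3_eq_cube)
  then have "1 \<le> (1 - y + y\<^sup>2) * (1 + y)"
    using assms by simp
  \<comment> \<open>A sum of squares: the factor has to be nonnegative before \<open>1 + y\<close>
    may be replaced by \<open>exp y\<close>.\<close>
  also have "1 - y + y\<^sup>2 = (1 - y / 2)\<^sup>2 + 3 / 4 * y\<^sup>2"
    by (simp add: algebra_simps power2_eq_square)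
  then have nonneg: "1 - y + y\<^sup>2 \<ge> 0"
    by simp
  then have "(1 - y + y\<^sup>2) * (1 + y) \<le> (1 - y + y\<^sup>2) * exp y"
    by (intro mult_left_mono exp_ge_add_one_self)
  finally show ?thesis
    by (simp add: exp_minus field_simps)
qed

text \<open>Weierstrass' product inequality, which is the union bound for independent
  events.\<close>

lemma one_minus_sum_le_prod:
  fixes x :: "'a \<Rightarrow> real"
  assumes "finite W" "\<And>w. w \<in> W \<Longrightarrow> 0 \<le> x w \<and> x w \<le> 1"
  shows "1 - (\<Sum>w\<in>W. x w) \<le> (\<Prod>w\<in>W. 1 - x w)"
  using assms
proof (induction rule: finite_induct)
  case (insert w W)
  have "(\<Prod>w\<in>W. 1 - x w) \<le> 1"
    using insert.prems by (intro prod_le_1) auto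
  then have "x w * (\<Prod>w\<in>W. 1 - x w) \<le> x w"
    using insert.prems[of w] by (intro mult_left_le) auto
  then show ?case
    using insert by (auto simp: left_diff_distrib)
qed auto

abbreviation affinity :: "real \<Rightarrow> real \<Rightarrow> nat \<Rightarrow> nat \<Rightarrow> real" where
  "affinity a b s s' \<equiv> (if s = s' then a else b)"

text \<open>The mean does not depend on \<open>s\<close>. This symmetry is why the missing edges
  reveal almost nothing about the labels inside the tree.\<close>

lemma expectation_affinity:
  assumes "s \<in> {1..k}"
  shows "measure_pmf.expectation (pmf_of_set {1..k}) (affinity a b s) = (a + (real k - 1) * b) / real k"
proof -
  have "(\<Sum>s'\<in>{1..k}. affinity a b s s') = a + (\<Sum>s'\<in>{1..k} - {s}. affinity a b s s')"
    using assms by (subst sum.remove[of _ s]) auto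
  also have "(\<Sum>s'\<in>{1..k} - {s}. affinity a b s s') = (\<Sum>s'\<in>{1..k} - {s}. b)"
    by (intro sum.cong) auto
  also have "\<dots> = (real k - 1) * b"
    using assms by (simp add: card_Diff_singleton of_nat_diff)
  finally show ?thesis
    using assms by (subst integral_pmf_of_set) auto
qed

lemma expectation_uniform_labels_prod:
  fixes g :: "nat \<Rightarrow> real"
  assumes "finite U" "k \<ge> 1" "\<And>s. s \<in> {1..k} \<Longrightarrow> g s \<ge> 0"
  shows "measure_pmf.expectation (uniform_labels U k) (\<lambda>\<sigma>. \<Prod>u\<in>U. g (\<sigma> u)) =
    measure_pmf.expectation (pmf_of_set {1..k}) g ^ card U"
proof -
  have "measure_pmf.expectation (uniform_labels U k) (\<lambda>\<sigma>. \<Prod>u\<in>U. g (\<sigma> u)) =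
     (\<Prod>u\<in>U. measure_pmf.expectation (pmf_of_set {1..k}) g)"
    using assms by (intro expectation_prod_Pi_pmf) (auto intro!: integrable_measure_pmf_finite)
  then show ?thesis by simp
qed

text \<open>An upper bound for \<open>E (Z - c)^2 = E Z^2 - 2 * c * E Z + c^2\<close> with
  \<open>c = exp (- m * d)\<close>, where \<open>m\<close> counts the inner vertices and
  \<open>N\<close> the vertices of the tree, so that \<open>n - N\<close> vertices lie outside. The
  first term bounds the second moment of \<open>Z\<close>; the power in the middle term bounds its
  mean from below.\<close>

definition concentration_err :: "real \<Rightarrow> real \<Rightarrow> nat \<Rightarrow> nat \<Rightarrow> nat \<Rightarrow> real" where
  "concentration_err a d m N n =
     exp ((real n - real N) * (- 2 * real m * d / n + 4 * (real m * a / n)\<^sup>2))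
     - 2 * exp (- (real m * d)) * (1 + (- (real m * d)) / n) ^ n + exp (- (real m * d)) ^ 2"

lemma tendsto_concentration_err:
  "(\<lambda>n. concentration_err a d m N n) \<longlonglongrightarrow> 0"
proof -
  have "(\<lambda>n. (real n - real N) * (- 2 * real m * d / n + 4 * (real m * a / n)\<^sup>2)) \<longlonglongrightarrow> - 2 * real m * d"
  proof (rule Lim_transform_eventually)
    show "(\<lambda>n. (1 - real N * (1 / real n)) * (- 2 * real m * d + 4 * (real m * a)\<^sup>2 * (1 / real n)))
        \<longlonglongrightarrow> - 2 * real m * d"
      by (auto intro!: tendsto_eq_intros lim_1_over_n)
    show "\<forall>\<^sub>F n in sequentially.
        (1 - real N * (1 / real n)) * (- 2 * real m * d + 4 * (real m * a)\<^sup>2 * (1 / real n)) =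
        (real n - real N) * (- 2 * real m * d / n + 4 * (real m * a / n)\<^sup>2)"
      using eventually_gt_at_top[of 0]
      by eventually_elim (simp add: field_simps power2_eq_square)
  qed
  moreover have "(\<lambda>n. (1 + (- (real m * d)) / real n) ^ n) \<longlonglongrightarrow> exp (- (real m * d))"
    by (rule tendsto_exp_limit_sequentially)
  ultimately have "(\<lambda>n. concentration_err a d m N n) \<longlonglongrightarrow>
      exp (- 2 * real m * d) - 2 * exp (- (real m * d)) * exp (- (real m * d)) + exp (- (real m * d)) ^ 2"
    unfolding concentration_err_def
    by (intro tendsto_add tendsto_diff tendsto_exp tendsto_mult_left tendsto_const)
  also have "exp (- 2 * real m * d) = exp (- (real m * d)) ^ 2"
    by (simp add: power2_eq_square flip: exp_add)
  finally show ?thesis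
    by (simp add: power2_eq_square)
qed

text \<open>
  The first and the second moment of the product factorise over \<open>U\<close>, so the bound is that on the
  mean square deviation.
\<close>

lemma concentration_prod:
  fixes \<tau> :: "nat \<Rightarrow> nat" and a b d :: real
  assumes U: "finite U" and W: "finite W" "\<And>w. w \<in> W \<Longrightarrow> \<tau> w \<in> {1..k}"
    and k: "k \<ge> 1" and ab: "0 \<le> b" "b \<le> a"
    and n: "n > 0" "a \<le> real n" "card U + N = n" "real (card W) * d \<le> real n"
    and d: "d = (a + (real k - 1) * b) / real k"
  shows "measure_pmf.expectation (uniform_labels U k)
      (\<lambda>\<sigma>. \<bar>(\<Prod>u\<in>U. \<Prod>w\<in>W. 1 - affinity a b (\<tau> w) (\<sigma> u) / n) - exp (- (real (card W) * d))\<bar>) \<le>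
    sqrt (concentration_err a d (card W) N n)"
proof -
  let ?m = "real (card W)"
  let ?P = "pmf_of_set {1..k}"
  define c where "c = exp (- (?m * d))"
  \<comment> \<open>For an outside vertex labelled \<open>s\<close>, \<open>S s\<close> is its mean
    number of edges to \<open>W\<close> and \<open>g s\<close> the probability that it has
    none.\<close>
  define S where "S = (\<lambda>s. \<Sum>w\<in>W. affinity a b (\<tau> w) s / n)"
  define g where "g = (\<lambda>s. \<Prod>w\<in>W. 1 - affinity a b (\<tau> w) s / n)"
  have finP: "finite (set_pmf ?P)"
    using k by (subst set_pmf_of_set) auto
  note int = integrable_measure_pmf_finite[OF finP]
  have x: "0 \<le> affinity a b (\<tau> w) s / n" "affinity a b (\<tau> w) s / n \<le> 1" "affinity a b (\<tau> w) s / n \<le> a / n" for w s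
    using ab n by (auto simp: field_simps)
  have S0: "0 \<le> S s" for s
    unfolding S_def using x by (intro sum_nonneg) auto
  have S1: "S s \<le> ?m * a / n" for s
    using sum_bounded_above[of W "\<lambda>w. affinity a b (\<tau> w) s / n" "a / n"] x(3) by (simp add: S_def)
  \<comment> \<open>At this point the dependence on the labels \<open>\<tau>\<close>
    disappears.\<close>
  have ES: "measure_pmf.expectation ?P S = ?m * d / n"
  proof -
    have "measure_pmf.expectation ?P S = (\<Sum>w\<in>W. measure_pmf.expectation ?P (affinity a b (\<tau> w)) / n)"
      unfolding S_def by (subst Bochner_Integration.integral_sum) (auto intro: int simp del: One_nat_def)
    also have "\<dots> = (\<Sum>w\<in>W. d / n)"
      unfolding d using W by (intro sum.cong refl arg_cong2[where f = "(/)"] expectation_affinity) auto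
    finally show ?thesis by simp
  qed
  have g0: "0 \<le> g s" for s
    unfolding g_def using x by (intro prod_nonneg) auto
  have g_lower: "1 - S s \<le> g s" for s
    unfolding g_def S_def using x W by (intro one_minus_sum_le_prod) auto
  have g_upper: "g s \<le> exp (- S s)" for s
  proof -
    have "g s \<le> (\<Prod>w\<in>W. exp (- (affinity a b (\<tau> w) s / n)))"
      unfolding g_def
    proof (intro prod_mono conjI)
      fix w
      show "0 \<le> 1 - affinity a b (\<tau> w) s / n"
        using x(2)[of w s] by simp
      show "1 - affinity a b (\<tau> w) s / n \<le> exp (- (affinity a b (\<tau> w) s / n))"
        using exp_ge_add_one_self[of "- (affinity a b (\<tau> w) s / n)"] by simp
    qed
    then show ?thesis
      by (simp add: S_def exp_sum W(1) sum_negf[symmetric])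
  qed
  have g2_upper: "(g s)\<^sup>2 \<le> 1 - 2 * S s + 4 * (?m * a / n)\<^sup>2" for s
  proof -
    have "(g s)\<^sup>2 \<le> (exp (- S s))\<^sup>2"
      using g0 g_upper by (intro power_mono) auto
    also have "\<dots> = exp (- (2 * S s))"
      by (simp add: power2_eq_square flip: exp_add)
    also have "\<dots> \<le> 1 - 2 * S s + (2 * S s)\<^sup>2"
      using S0 by (intro exp_minus_le) auto
    also have "(2 * S s)\<^sup>2 = 4 * (S s)\<^sup>2"
      by (simp add: power2_eq_square)
    \<comment> \<open>The quadratic term is of order \<open>1 / n^2\<close>, so over at most
      \<open>n\<close> outside vertices it contributes only \<open>O(1 / n)\<close> to the
      exponent.\<close>
    also have "4 * (S s)\<^sup>2 \<le> 4 * (?m * a / n)\<^sup>2"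
      using S0 S1 by (intro mult_left_mono power_mono) auto
    finally show ?thesis by simp
  qed
  have Eg: "1 - ?m * d / n \<le> measure_pmf.expectation ?P g"
  proof -
    have "measure_pmf.expectation ?P (\<lambda>s. 1 - S s) \<le> measure_pmf.expectation ?P g"
      using g_lower by (intro expectation_mono_finite finP) auto
    then show ?thesis
      by (simp add: int ES del: One_nat_def)
  qed
  have Eg2: "measure_pmf.expectation ?P (\<lambda>s. (g s)\<^sup>2) \<le> 1 - 2 * ?m * d / n + 4 * (?m * a / n)\<^sup>2"
  proof -
    have "measure_pmf.expectation ?P (\<lambda>s. (g s)\<^sup>2) \<le>
        measure_pmf.expectation ?P (\<lambda>s. 1 - 2 * S s + 4 * (?m * a / n)\<^sup>2)"
      using g2_upper by (intro expectation_mono_finite finP) auto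
    then show ?thesis
      by (simp add: int ES del: One_nat_def)
  qed
  define Z where "Z = (\<lambda>\<sigma>. \<Prod>u\<in>U. g (\<sigma> u))"
  let ?Q = "uniform_labels U k"
  have finQ: "finite (set_pmf ?Q)"
    using U k by (rule finite_set_uniform_labels)
  note intQ = integrable_measure_pmf_finite[OF finQ]
  have cardU: "real (card U) = real n - real N" "card U \<le> n"
    using n(3) by auto
  have EZ2: "measure_pmf.expectation ?Q (\<lambda>\<sigma>. (Z \<sigma>)\<^sup>2) \<le>
      exp ((real n - real N) * (- 2 * ?m * d / n + 4 * (?m * a / n)\<^sup>2))"
  proof -
    have "measure_pmf.expectation ?Q (\<lambda>\<sigma>. (Z \<sigma>)\<^sup>2) = measure_pmf.expectation ?P (\<lambda>s. (g s)\<^sup>2) ^ card U"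
      unfolding Z_def prod_power_distrib
      by (rule expectation_uniform_labels_prod[OF U k]) auto
    also have "\<dots> \<le> (1 - 2 * ?m * d / n + 4 * (?m * a / n)\<^sup>2) ^ card U"
      by (intro power_mono Eg2) (auto intro!: Bochner_Integration.integral_nonneg)
    also have "\<dots> \<le> exp (- 2 * ?m * d / n + 4 * (?m * a / n)\<^sup>2) ^ card U"
    proof (rule power_mono)
      show "1 - 2 * ?m * d / n + 4 * (?m * a / n)\<^sup>2 \<le> exp (- 2 * ?m * d / n + 4 * (?m * a / n)\<^sup>2)"
        using exp_ge_add_one_self[of "- 2 * ?m * d / n + 4 * (?m * a / n)\<^sup>2"] by argo
      have "0 \<le> measure_pmf.expectation ?P (\<lambda>s. (g s)\<^sup>2)"
        by (intro Bochner_Integration.integral_nonneg) auto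
      then show "0 \<le> 1 - 2 * ?m * d / n + 4 * (?m * a / n)\<^sup>2"
        using Eg2 by linarith
    qed
    finally show ?thesis
      by (simp add: exp_of_nat_mult[symmetric] cardU)
  qed
  have EZ: "(1 + (- (?m * d)) / n) ^ n \<le> measure_pmf.expectation ?Q Z"
  proof -
    have d0: "0 \<le> d"
      unfolding d using ab k by (intro divide_nonneg_nonneg add_nonneg_nonneg mult_nonneg_nonneg) auto
    have le: "0 \<le> 1 + (- (?m * d)) / n" "1 + (- (?m * d)) / n \<le> 1"
      using n d0 by (auto simp: field_simps)
    \<comment> \<open>The base lies in \<open>[0, 1]\<close>, so raising the exponent from
      \<open>card U\<close> to \<open>n\<close> only lowers the bound, and it brings about the
      standard form of the exponential limit. The lower end 0 comes from
      \<open>card W * d \<le> n\<close>.\<close>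
    have "(1 + (- (?m * d)) / n) ^ n \<le> (1 + (- (?m * d)) / n) ^ card U"
      using le cardU(2) by (intro power_decreasing)
    also have "\<dots> \<le> measure_pmf.expectation ?P g ^ card U"
      using Eg le by (intro power_mono) auto
    also have "\<dots> = measure_pmf.expectation ?Q Z"
      unfolding Z_def by (rule expectation_uniform_labels_prod[OF U k, symmetric]) (rule g0)
    finally show ?thesis .
  qed
  have "measure_pmf.expectation ?Q (\<lambda>\<sigma>. (Z \<sigma> - c)\<^sup>2) =
      measure_pmf.expectation ?Q (\<lambda>\<sigma>. (Z \<sigma>)\<^sup>2) - 2 * c * measure_pmf.expectation ?Q Z + c\<^sup>2"
  proof -
    have "(Z \<sigma> - c)\<^sup>2 = (Z \<sigma>)\<^sup>2 - 2 * c * Z \<sigma> + c\<^sup>2" for \<sigma>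
      by (simp add: power2_diff)
    then show ?thesis
      by (simp add: intQ del: One_nat_def)
  qed
  also have "\<dots> \<le> concentration_err a d (card W) N n"
  proof -
    have "2 * c * (1 + (- (?m * d)) / n) ^ n \<le> 2 * c * measure_pmf.expectation ?Q Z"
      using EZ by (intro mult_left_mono) (auto simp: c_def)
    then show ?thesis
      using EZ2 unfolding concentration_err_def c_def by linarith
  qed
  finally have "sqrt (measure_pmf.expectation ?Q (\<lambda>\<sigma>. (Z \<sigma> - c)\<^sup>2)) \<le> sqrt (concentration_err a d (card W) N n)"
    by (rule real_sqrt_le_mono)
  with expectation_abs_le_sqrt[OF finQ, of "\<lambda>\<sigma>. Z \<sigma> - c"] show ?thesis
    unfolding Z_def g_def c_def by (rule order.trans)
qed

section \<open>Decomposing the block model along an explored tree\<close>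

lemma random_subset_union:
  assumes "finite A" "finite B" "A \<inter> B = {}"
  shows "random_subset (A \<union> B) q =
    bind_pmf (random_subset A q) (\<lambda>S. map_pmf (\<lambda>S'. S \<union> S') (random_subset B q))"
  unfolding random_subset_def Pi_pmf_union[OF assms]
  by (simp add: pair_pmf_def map_pmf_def bind_assoc_pmf bind_return_pmf)
     (intro bind_pmf_cong refl arg_cong[where f = return_pmf], use assms(3) in auto)

lemma random_subset_cong:
  assumes "\<And>x. x \<in> A \<Longrightarrow> q x = q' x"
  shows "random_subset A q = random_subset A q'"
proof -
  have "Pi_pmf A False (\<lambda>x. bernoulli_pmf (q x)) = Pi_pmf A False (\<lambda>x. bernoulli_pmf (q' x))"
    by (rule Pi_pmf_cong) (simp_all add: assms)
  then show ?thesis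
    by (simp add: random_subset_def)
qed

lemma set_random_subset: "set_pmf (random_subset A q) \<subseteq> Pow A"
  unfolding random_subset_def set_map_pmf by (rule image_subsetI) simp

lemma finite_set_random_subset [simp]: "finite A \<Longrightarrow> finite (set_pmf (random_subset A q))"
  by (rule finite_subset[OF set_random_subset]) simp

lemma expectation_random_subset_union:
  fixes F :: "'a set \<Rightarrow> real"
  assumes "finite A" "finite B" "A \<inter> B = {}"
  shows "measure_pmf.expectation (random_subset (A \<union> B) q) F =
    measure_pmf.expectation (random_subset A q) (\<lambda>S.
      measure_pmf.expectation (random_subset B q) (\<lambda>S'. F (S \<union> S')))"
  unfolding random_subset_union[OF assms] using assms by (simp add: expectation_bind_finite)

lemma pmf_random_subset:
  assumes "finite A" "E \<subseteq> A" "\<And>x. x \<in> A \<Longrightarrow> 0 \<le> q x \<and> q x \<le> 1"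
  shows "pmf (random_subset A q) E = (\<Prod>x\<in>E. q x) * (\<Prod>x\<in>A - E. 1 - q x)"
proof -
  have "(\<lambda>f. {x \<in> A. f x}) -` {E} = Pi A (\<lambda>x. {x \<in> E})"
    using assms(2) by (auto simp: Pi_def)
  then have "pmf (random_subset A q) E =
      measure_pmf.prob (Pi_pmf A False (\<lambda>x. bernoulli_pmf (q x))) (Pi A (\<lambda>x. {x \<in> E}))"
    by (simp add: random_subset_def pmf_map)
  also have "\<dots> = (\<Prod>x\<in>A. measure_pmf.prob (bernoulli_pmf (q x)) {x \<in> E})"
    by (rule measure_Pi_pmf_Pi) fact
  also have "\<dots> = (\<Prod>x\<in>A. if x \<in> E then q x else 1 - q x)"
    using assms(3) by (intro prod.cong) (auto simp: measure_pmf_single)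
  also have "\<dots> = (\<Prod>x\<in>A \<inter> E. q x) * (\<Prod>x\<in>A - E. 1 - q x)"
    using assms(1) by (subst prod.If_cases) (auto simp: Diff_eq)
  also have "A \<inter> E = E"
    using assms(2) by auto
  finally show ?thesis .
qed

abbreviation edge_rate :: "nat \<Rightarrow> real \<Rightarrow> real \<Rightarrow> (nat \<Rightarrow> nat) \<Rightarrow> nat set \<Rightarrow> real" where
  "edge_rate n a b \<sigma> e \<equiv> (if \<forall>u\<in>e. \<forall>v\<in>e. \<sigma> u = \<sigma> v then a / real n else b / real n)"

lemma edge_rate_doubleton: "edge_rate n a b \<sigma> {x, y} = affinity a b (\<sigma> x) (\<sigma> y) / n"
  by (cases "\<sigma> x = \<sigma> y") simp_all

lemma labeled_sbm_conv:
  "labeled_sbm n k a b p =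
    bind_pmf (uniform_labels {1..n} k) (\<lambda>\<sigma>.
    bind_pmf (random_subset (pairs n) (edge_rate n a b \<sigma>)) (\<lambda>G.
    map_pmf (\<lambda>R. (G, R, \<sigma>)) (random_subset {1..n} (\<lambda>_. p))))"
  by (simp add: labeled_sbm_def map_pmf_def)

lemma finite_set_labeled_sbm: "k \<ge> 1 \<Longrightarrow> finite (set_pmf (labeled_sbm n k a b p))"
  unfolding labeled_sbm_conv set_bind_pmf set_map_pmf
  by (intro finite_UN_I finite_imageI finite_set_uniform_labels finite_set_random_subset finite_pairs) auto

lemma expectation_labeled_sbm:
  fixes F :: "_ \<Rightarrow> real"
  assumes "k \<ge> 1"
  shows "measure_pmf.expectation (labeled_sbm n k a b p) F =
    measure_pmf.expectation (uniform_labels {1..n} k) (\<lambda>\<sigma>.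
    measure_pmf.expectation (random_subset (pairs n) (edge_rate n a b \<sigma>)) (\<lambda>G.
    measure_pmf.expectation (random_subset {1..n} (\<lambda>_. p)) (\<lambda>R. F (G, R, \<sigma>))))"
  unfolding labeled_sbm_conv
  by (subst expectation_bind_finite)
     (use assms in \<open>auto simp: expectation_bind_finite finite_pairs simp del: One_nat_def
       intro!: finite_set_uniform_labels\<close>)

section \<open>Separating the edges at the inner vertices from the rest\<close>

definition touching :: "nat \<Rightarrow> nat set \<Rightarrow> nat set set" where
  "touching n I = {e \<in> pairs n. e \<inter> I \<noteq> {}}"

lemma finite_touching: "finite (touching n I)"
  by (rule finite_subset[OF _ finite_pairs[of n]]) (auto simp: touching_def)

text \<open>Whether \<open>T\<close> is explored is decided by the edges touching its inner vertices
  alone. These are independent of the other edges, and on this event they are exactly the edges of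
  \<open>T\<close>.\<close>

lemma expectation_random_subset_explored:
  fixes f :: "nat set set \<Rightarrow> real"
  shows "measure_pmf.expectation (random_subset (pairs n) q) (\<lambda>G. of_bool (explored r G T) * f G) =
    pmf (random_subset (touching n (set (inner_nodes r T))) q) (edge_set T) *
    measure_pmf.expectation (random_subset (pairs n - touching n (set (inner_nodes r T))) q)
      (\<lambda>G. f (edge_set T \<union> G))"
proof -
  let ?A = "touching n (set (inner_nodes r T))" and ?B = "pairs n - touching n (set (inner_nodes r T))"
  have fin: "finite ?A" "finite ?B"
    using finite_touching finite_pairs by auto
  have pairs: "pairs n = ?A \<union> ?B"
    by (auto simp: touching_def)
  have "measure_pmf.expectation (random_subset (pairs n) q) (\<lambda>G. of_bool (explored r G T) * f G) =
    measure_pmf.expectation (random_subset ?A q) (\<lambda>S. measure_pmf.expectation (random_subset ?B q)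
      (\<lambda>S'. of_bool (explored r (S \<union> S') T) * f (S \<union> S')))"
    by (subst pairs, rule expectation_random_subset_union[OF fin]) auto
  also have "\<dots> = measure_pmf.expectation (random_subset ?A q) (\<lambda>S. indicator {edge_set T} S *
      measure_pmf.expectation (random_subset ?B q) (\<lambda>G. f (edge_set T \<union> G)))"
  proof (intro integral_cong_AE AE_pmfI)
    fix S assume "S \<in> set_pmf (random_subset ?A q)"
    then have S: "S \<subseteq> ?A"
      using set_random_subset by blast
    have "measure_pmf.expectation (random_subset ?B q) (\<lambda>S'. of_bool (explored r (S \<union> S') T) * f (S \<union> S')) =
      measure_pmf.expectation (random_subset ?B q) (\<lambda>S'. indicator {edge_set T} S * f (edge_set T \<union> S'))"
    proof (intro integral_cong_AE AE_pmfI)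
      fix S' assume "S' \<in> set_pmf (random_subset ?B q)"
      then have "S' \<subseteq> ?B"
        using set_random_subset by blast
      then have "{e \<in> S \<union> S'. e \<inter> set (inner_nodes r T) \<noteq> {}} = S"
        using S by (auto simp: touching_def)
      then show "of_bool (explored r (S \<union> S') T) * f (S \<union> S') = indicator {edge_set T} S * f (edge_set T \<union> S')"
        by (auto simp: explored_def indicator_def)
    qed auto
    then show "measure_pmf.expectation (random_subset ?B q) (\<lambda>S'. of_bool (explored r (S \<union> S') T) * f (S \<union> S')) =
      indicator {edge_set T} S * measure_pmf.expectation (random_subset ?B q) (\<lambda>G. f (edge_set T \<union> G))"
      by simp
  qed auto
  also have "\<dots> = pmf (random_subset ?A q) (edge_set T) *
      measure_pmf.expectation (random_subset ?B q) (\<lambda>G. f (edge_set T \<union> G))"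
    by (simp add: measure_pmf_single)
  finally show ?thesis .
qed

text \<open>What remains of the test function once the edges at the inner vertices are fixed to
  those of \<open>T\<close> and the rest of the graph and the revealed set are averaged out. The
  labels stay as a parameter.\<close>

definition unrevealed_avg ::
    "nat \<Rightarrow> real \<Rightarrow> real \<Rightarrow> real \<Rightarrow> nat \<Rightarrow> nat rtree \<Rightarrow> (nat set set \<times> nat set \<times> (nat \<Rightarrow> nat) \<Rightarrow> real)
     \<Rightarrow> (nat \<Rightarrow> nat) \<Rightarrow> real" where
  "unrevealed_avg n a b p r T f \<sigma> =
     measure_pmf.expectation (random_subset (pairs n - touching n (set (inner_nodes r T))) (edge_rate n a b \<sigma>)) (\<lambda>G.
     measure_pmf.expectation (random_subset {1..n} (\<lambda>_. p)) (\<lambda>R.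
       of_bool (R \<inter> set (inner_nodes r T) = {}) * f (edge_set T \<union> G, R, restrict \<sigma> R)))"

lemma expectation_labeled_sbm_explored:
  assumes "k \<ge> 1"
  shows "measure_pmf.expectation (labeled_sbm n k a b p) (\<lambda>(G, R, \<sigma>).
      of_bool (explored r G T) * of_bool (R \<inter> set (inner_nodes r T) = {}) * (h (\<sigma> v) * f (G, R, restrict \<sigma> R))) =
    measure_pmf.expectation (uniform_labels {1..n} k) (\<lambda>\<sigma>. h (\<sigma> v) *
      pmf (random_subset (touching n (set (inner_nodes r T))) (edge_rate n a b \<sigma>)) (edge_set T) *
      unrevealed_avg n a b p r T f \<sigma>)"
proof -
  have "measure_pmf.expectation (random_subset (pairs n) (edge_rate n a b \<sigma>)) (\<lambda>G.
      measure_pmf.expectation (random_subset {1..n} (\<lambda>_. p)) (\<lambda>R.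
      of_bool (explored r G T) * of_bool (R \<inter> set (inner_nodes r T) = {}) * (h (\<sigma> v) * f (G, R, restrict \<sigma> R)))) =
    h (\<sigma> v) * pmf (random_subset (touching n (set (inner_nodes r T))) (edge_rate n a b \<sigma>)) (edge_set T) *
      unrevealed_avg n a b p r T f \<sigma>" for \<sigma>
  proof -
    have "measure_pmf.expectation (random_subset {1..n} (\<lambda>_. p)) (\<lambda>R.
      of_bool (explored r G T) * of_bool (R \<inter> set (inner_nodes r T) = {}) * (h (\<sigma> v) * f (G, R, restrict \<sigma> R))) =
      h (\<sigma> v) * (of_bool (explored r G T) * measure_pmf.expectation (random_subset {1..n} (\<lambda>_. p)) (\<lambda>R.
        of_bool (R \<inter> set (inner_nodes r T) = {}) * f (G, R, restrict \<sigma> R)))" for G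
      by (simp add: mult_ac)
    then show ?thesis
      by (simp add: expectation_random_subset_explored unrevealed_avg_def mult_ac)
  qed
  then show ?thesis
    by (simp add: expectation_labeled_sbm[OF assms])
qed

lemma abs_unrevealed_avg_le:
  assumes "\<And>y. \<bar>f y\<bar> \<le> 1"
  shows "\<bar>unrevealed_avg n a b p r T f \<sigma>\<bar> \<le> 1"
proof -
  have le1: "\<bar>measure_pmf.expectation M g\<bar> \<le> 1" if "finite (set_pmf M)" "\<And>x. \<bar>g x\<bar> \<le> 1"
    for M :: "'c pmf" and g :: "'c \<Rightarrow> real"
    using abs_expectation_le[OF that(1), of g "\<lambda>_. 1"] that(2) by simp
  have fin: "finite (pairs n - touching n (set (inner_nodes r T)))"
    using finite_pairs by auto
  show ?thesis
    unfolding unrevealed_avg_def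
    by (intro le1 finite_set_random_subset fin) (auto simp: abs_mult assms mult_le_one)
qed

text \<open>The Markov property in the form that is needed: the rates of the remaining edges do not
  involve inner labels, and the restricted labelling does not show them as long as no inner vertex
  is revealed.\<close>

lemma unrevealed_avg_cong:
  assumes "\<And>x. x \<notin> set (inner_nodes r T) \<Longrightarrow> \<sigma> x = \<sigma>' x"
  shows "unrevealed_avg n a b p r T f \<sigma> = unrevealed_avg n a b p r T f \<sigma>'"
proof -
  have 1: "random_subset (pairs n - touching n (set (inner_nodes r T))) (edge_rate n a b \<sigma>) =
    random_subset (pairs n - touching n (set (inner_nodes r T))) (edge_rate n a b \<sigma>')"
  proof (rule random_subset_cong)
    fix e assume "e \<in> pairs n - touching n (set (inner_nodes r T))"
    then have "\<sigma> x = \<sigma>' x" if "x \<in> e" for x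
      using that assms by (auto simp: touching_def)
    then show "edge_rate n a b \<sigma> e = edge_rate n a b \<sigma>' e"
      by simp
  qed
  have 2: "of_bool (R \<inter> set (inner_nodes r T) = {}) * f (edge_set T \<union> G, R, restrict \<sigma> R) =
      of_bool (R \<inter> set (inner_nodes r T) = {}) * f (edge_set T \<union> G, R, restrict \<sigma>' R)" for G R
  proof (cases "R \<inter> set (inner_nodes r T) = {}")
    case True
    then have "restrict \<sigma> R = restrict \<sigma>' R"
      using assms by (intro restrict_ext) auto
    then show ?thesis by simp
  qed simp
  show ?thesis
    unfolding unrevealed_avg_def 1 2 ..
qed

text \<open>For the test function 1 only the event that no inner vertex is revealed is left. Its
  probability does not involve \<open>\<sigma>\<close> and can be taken out of the expectation over
  the labels.\<close>

lemma unrevealed_avg_1: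
  assumes "0 \<le> p" "p \<le> 1" "set (inner_nodes r T) \<subseteq> {1..n}"
  shows "unrevealed_avg n a b p r T (\<lambda>_. 1) \<sigma> = (1 - p) ^ card (set (inner_nodes r T))"
proof -
  let ?I = "set (inner_nodes r T)"
  have V: "{1..n} = ?I \<union> ({1..n} - ?I)"
    using assms(3) by auto
  have "measure_pmf.expectation (random_subset {1..n} (\<lambda>_. p)) (\<lambda>R. of_bool (R \<inter> ?I = {}) :: real) =
    measure_pmf.expectation (random_subset ?I (\<lambda>_. p)) (\<lambda>S.
      measure_pmf.expectation (random_subset ({1..n} - ?I) (\<lambda>_. p)) (\<lambda>S'. of_bool ((S \<union> S') \<inter> ?I = {})))"
    by (subst V, rule expectation_random_subset_union) auto
  also have "\<dots> = measure_pmf.expectation (random_subset ?I (\<lambda>_. p)) (\<lambda>S. indicator {{}} S)"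
  proof (intro integral_cong_AE AE_pmfI)
    fix S assume "S \<in> set_pmf (random_subset ?I (\<lambda>_. p))"
    then have S: "S \<subseteq> ?I"
      using set_random_subset by blast
    have "measure_pmf.expectation (random_subset ({1..n} - ?I) (\<lambda>_. p)) (\<lambda>S'. of_bool ((S \<union> S') \<inter> ?I = {})) =
      measure_pmf.expectation (random_subset ({1..n} - ?I) (\<lambda>_. p)) (\<lambda>S'. indicator {{}} S :: real)"
    proof (intro integral_cong_AE AE_pmfI)
      fix S' assume "S' \<in> set_pmf (random_subset ({1..n} - ?I) (\<lambda>_. p))"
      then have "S' \<subseteq> {1..n} - ?I"
        using set_random_subset by blast
      then show "of_bool ((S \<union> S') \<inter> ?I = {}) = (indicator {{}} S :: real)"
        using S by (auto simp: indicator_def)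
    qed auto
    then show "measure_pmf.expectation (random_subset ({1..n} - ?I) (\<lambda>_. p)) (\<lambda>S'. of_bool ((S \<union> S') \<inter> ?I = {})) =
      (indicator {{}} S :: real)"
      by simp
  qed auto
  also have "\<dots> = pmf (random_subset ?I (\<lambda>_. p)) {}"
    by (simp add: measure_pmf_single)
  also have "\<dots> = (1 - p) ^ card ?I"
    using assms by (subst pmf_random_subset) auto
  finally show ?thesis
    by (simp add: unrevealed_avg_def)
qed

lemma expectation_uniform_labels_union:
  fixes F :: "(nat \<Rightarrow> nat) \<Rightarrow> real"
  assumes "finite A" "finite B" "A \<inter> B = {}" "k \<ge> 1"
  shows "measure_pmf.expectation (uniform_labels (A \<union> B) k) F =
    measure_pmf.expectation (uniform_labels A k) (\<lambda>f. measure_pmf.expectation (uniform_labels B k) (\<lambda>g.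
      F (\<lambda>x. if x \<in> A then f x else g x)))"
proof -
  have "uniform_labels (A \<union> B) k = bind_pmf (uniform_labels A k) (\<lambda>f.
      map_pmf (\<lambda>g x. if x \<in> A then f x else g x) (uniform_labels B k))"
    unfolding Pi_pmf_union[OF assms(1-3)] pair_pmf_def map_bind_pmf by (simp add: map_pmf_def bind_return_pmf)
  then show ?thesis
    using assms by (simp add: expectation_bind_finite del: One_nat_def)
qed

section \<open>Products over the edges of a tree\<close>

lemma map_snd_edges: "map snd (edges T) = tl (nodes T)"
proof (induction T)
  case (Node x ts)
  have "map snd ((x, root t) # edges t) = nodes t" if "t \<in> set ts" for t
    using Node.IH[OF that] by (cases t) auto
  then show ?case
    by (auto simp: map_concat comp_def intro!: arg_cong[where f = concat])
qed

text \<open>No edge ends at the root, and different subtrees have disjoint node sets; hence two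
  opposite edges would lie in one common subtree.\<close>

lemma edges_asym:
  "distinct (nodes T) \<Longrightarrow> (x, y) \<in> set (edges T) \<Longrightarrow> (y, x) \<notin> set (edges T)"
proof (induction T)
  case (Node z ts)
  have dist: "distinct (concat (map nodes ts))" and z: "z \<notin> set (concat (map nodes ts))"
    using Node.prems(1) by auto
  have not_z: "snd e \<noteq> z" if "e \<in> set (edges (Node z ts))" for e
  proof -
    have "snd e \<in> set (map snd (edges (Node z ts)))"
      using that by (metis image_eqI list.set_map)
    then have "snd e \<in> set (concat (map nodes ts))"
      unfolding map_snd_edges by simp
    with z show ?thesis by metis
  qed
  show ?case
  proof
    assume yx: "(y, x) \<in> set (edges (Node z ts))"
    have "x \<noteq> z" "y \<noteq> z"
      using not_z[OF yx] not_z[OF Node.prems(2)] by auto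
    then obtain t t' where t: "t \<in> set ts" "(x, y) \<in> set (edges t)"
      and t': "t' \<in> set ts" "(y, x) \<in> set (edges t')"
      using yx Node.prems(2) by auto
    have "x \<in> set (nodes t)" "x \<in> set (nodes t')"
      using t t' edges_subset by blast+
    then have "t = t'"
      using distinct_concat_nodes_unique[OF dist t(1) t'(1)] by blast
    then show False
      using Node.IH[OF t(1) distinct_concat_nodes_child[OF dist t(1)] t(2)] t'(2) by blast
  qed
qed

text \<open>Every node but the root is the end of exactly one edge, so no edge is listed twice; as
  none occurs in both directions either, nothing is lost by passing to unordered pairs.\<close>

lemma prod_edge_set:
  fixes g :: "'a set \<Rightarrow> real"
  assumes "distinct (nodes T)"
  shows "(\<Prod>e\<in>edge_set T. g e) = (\<Prod>(x, y)\<leftarrow>edges T. g {x, y})"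
proof -
  have dist_snd: "distinct (map snd (edges T))"
    unfolding map_snd_edges using assms by (rule distinct_tl)
  then have dist: "distinct (edges T)" and inj_snd: "inj_on snd (set (edges T))"
    by (auto simp: distinct_map)
  have inj: "inj_on (\<lambda>(x, y). {x, y}) (set (edges T))"
  proof (rule inj_onI, clarify)
    fix x y x' y' assume e: "(x, y) \<in> set (edges T)" "(x', y') \<in> set (edges T)" "{x, y} = {x', y'}"
    then have "(x = x' \<and> y = y') \<or> (x = y' \<and> y = x')"
      by (auto simp: doubleton_eq_iff)
    with e edges_asym[OF assms e(1)] show "x = x' \<and> y = y'"
      by auto
  qed
  have "(\<Prod>e\<in>edge_set T. g e) = (\<Prod>p\<in>set (edges T). g (case p of (x, y) \<Rightarrow> {x, y}))"
    by (subst prod.reindex[OF inj]) (simp add: comp_def)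
  also have "\<dots> = (\<Prod>(x, y)\<leftarrow>edges T. g {x, y})"
    by (subst prod.distinct_set_conv_list[OF dist]) (simp add: case_prod_unfold)
  finally show ?thesis .
qed

text \<open>This identity is the origin of \<open>d\<close> and \<open>\<eta>\<close>. With
  \<open>D = a + (k - 1) * b\<close> one has \<open>d * k = D\<close>; the label is kept with
  probability \<open>a / D\<close>, and each of the other \<open>k - 1\<close> labels is taken with
  probability \<open>b / D\<close>.\<close>

lemma edge_prob_affinity:
  assumes "k \<ge> 1" "0 \<le> b" "b < a" "s \<in> {1..k}" "s' \<in> {1..k}"
    and d: "d = (a + (real k - 1) * b) / real k" and \<eta>: "\<eta> = b / (a + (real k - 1) * b)"
  shows "d * (real k * edge_prob k \<eta> s s') = affinity a b s s'"
proof -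
  define D where "D = a + (real k - 1) * b"
  have D: "D > 0"
    unfolding D_def using assms(1-3) by (intro add_pos_nonneg mult_nonneg_nonneg) auto
  have keep: "1 - (real k - 1) * \<eta> = a / D"
    using D by (simp add: \<eta> D_def field_simps)
  have "edge_prob k \<eta> s s' = measure_pmf.expectation (bernoulli_pmf (a / D))
      (\<lambda>c. pmf (if c then return_pmf s else pmf_of_set ({1..k} - {s})) s')"
    unfolding broadcast_edge_def pmf_bind keep ..
  also have "\<dots> = pmf (return_pmf s) s' * (a / D) + pmf (pmf_of_set ({1..k} - {s})) s' * (1 - a / D)"
    using assms(1-3) D by (subst integral_bernoulli_pmf) (auto simp: D_def divide_simps)
  also have "1 - a / D = (real k - 1) * b / D"
    using D by (simp add: D_def field_simps)
  also have "pmf (pmf_of_set ({1..k} - {s})) s' * ((real k - 1) * b / D) = of_bool (s \<noteq> s') * b / D"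
  proof (cases "k = 1")
    \<comment> \<open>There is no other label, but moving away from \<open>s\<close> has probability
      0 and \<open>s = s'\<close>, so both sides vanish.\<close>
    case True
    then show ?thesis using assms(4,5) by auto
  next
    case False
    then have "2 \<le> k"
      using assms(1) by simp
    have card: "card ({1..k} - {s}) = k - 1"
      using assms(4) by (simp add: card_Diff_singleton)
    with \<open>2 \<le> k\<close> have "card ({1..k} - {s}) > 0"
      by simp
    then have "{1..k} - {s} \<noteq> {}"
      unfolding card_gt_0_iff by blast
    then have "pmf (pmf_of_set ({1..k} - {s})) s' = of_bool (s \<noteq> s') / (real k - 1)"
      using card assms(1,5) by (subst pmf_of_set) (auto simp: of_nat_diff indicator_def)
    then show ?thesis
      using \<open>2 \<le> k\<close> by simp
  qed
  finally have "edge_prob k \<eta> s s' = of_bool (s = s') * a / D + of_bool (s \<noteq> s') * b / D"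
    by (auto simp: indicator_def)
  moreover have "d * real k = D"
    using assms(1) by (simp add: d D_def)
  ultimately show ?thesis
    using D by (auto simp: mult.assoc[symmetric])
qed

text \<open>The square root accounts for the missing edges to vertices outside the tree. The second
  summand accounts for the missing edges between vertices of the tree: fewer than
  \<open>2 ^ length (nodes t)\<close> pairs, each missing with probability at least
  \<open>1 - a / n\<close>.\<close>

definition embedding_err :: "nat \<Rightarrow> real \<Rightarrow> real \<Rightarrow> unit rtree \<Rightarrow> nat \<Rightarrow> real" where
  "embedding_err r a d t n =
    sqrt (concentration_err a d (length (inner_nodes r t)) (length (nodes t)) n) +
    (1 - (1 - a / n) ^ (2 ^ length (nodes t)))"

lemma tendsto_embedding_err: "embedding_err r a d t \<longlonglongrightarrow> 0"
proof -
  have "(\<lambda>n. embedding_err r a d t n) \<longlonglongrightarrow> sqrt 0 + (1 - (1 - 0) ^ (2 ^ length (nodes t)))"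
    unfolding embedding_err_def
    by (intro tendsto_intros tendsto_concentration_err lim_const_over_n)
  then show ?thesis by simp
qed

section \<open>The contribution of a single embedding\<close>

locale sbm_embedding =
  fixes n k r v :: nat and a b d \<eta> :: real and t :: "unit rtree" and T :: "nat rtree"
  assumes k: "k \<ge> 1" and ab: "0 \<le> b" "b < a"
    and d: "d = (a + (real k - 1) * b) / real k" and \<eta>: "\<eta> = b / (a + (real k - 1) * b)"
    and T: "T \<in> embeddings n v t" and height: "height_le r t"
    and n: "n > 0" "a \<le> real n" "real (length (nodes t)) * d \<le> real n"
begin

abbreviation "I \<equiv> set (inner_nodes r T)"
abbreviation "V \<equiv> {1..n}"
abbreviation "U \<equiv> {1..n} - set (nodes T)"
abbreviation "L \<equiv> length (edges t)"

text \<open>The value around which \<open>X\<close> concentrates, and at the same time the product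
  of the exponential factors in \<open>pmf_gw_tree\<close>.\<close>

definition c :: real where
  "c = exp (- (real (length (inner_nodes r t)) * d))"

text \<open>The density of the broadcast law with respect to uniform labels, evaluated along
  \<open>T\<close>.\<close>

definition W :: "(nat \<Rightarrow> nat) \<Rightarrow> real" where
  "W \<sigma> = (\<Prod>(x, y)\<leftarrow>edges T. real k * edge_prob k \<eta> (\<sigma> x) (\<sigma> y))"

text \<open>Given the labels, the probability that no edge other than those of \<open>T\<close>
  touches an inner vertex.\<close>

definition X :: "(nat \<Rightarrow> nat) \<Rightarrow> real" where
  "X \<sigma> = (\<Prod>e\<in>touching n I - edge_set T. 1 - edge_rate n a b \<sigma> e)"

text \<open>The part of \<open>X\<close> that comes from pairs leaving the tree. Given the labels of
  the tree it is a product of independent factors, one for each outside vertex.\<close>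

definition Z :: "(nat \<Rightarrow> nat) \<Rightarrow> real" where
  "Z \<sigma> = (\<Prod>u\<in>U. \<Prod>w\<in>I. 1 - affinity a b (\<sigma> w) (\<sigma> u) / n)"

abbreviation err :: real where
  "err \<equiv> embedding_err r a d t n"

lemma shape: "shape T = t" and dist: "distinct (nodes T)" and nodes: "set (nodes T) \<subseteq> V" and root: "root T = v"
  using T by (auto simp: embeddings_def)

lemma height_T: "height_le r T"
  using height shape by (metis height_le_map_rtree)

lemma lengths: "length (nodes T) = length (nodes t)" "length (edges T) = L"
    "length (inner_nodes r T) = length (inner_nodes r t)"
  unfolding shape[symmetric] by (simp_all add: nodes_map_rtree edges_map_rtree inner_nodes_map_rtree)

lemma v_in: "v \<in> set (nodes T)"
  using root root_in_nodes by metis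

lemma distinct_inner_level: "distinct (inner_nodes r T @ level r T)"
  and set_inner_level: "set (nodes T) = I \<union> set (level r T)"
proof -
  have m: "mset (nodes T) = mset (inner_nodes r T @ level r T)"
    using mset_nodes[OF height_T] by simp
  then show "distinct (inner_nodes r T @ level r T)"
    using dist by (metis mset_eq_imp_distinct_iff)
  show "set (nodes T) = I \<union> set (level r T)"
    using mset_eq_setD[OF m] by simp
qed

lemma card_I: "card I = length (inner_nodes r t)"
  using distinct_inner_level lengths by (simp add: distinct_card)

lemma I_subset: "I \<subseteq> set (nodes T)"
  by (rule set_inner_nodes_subset)

lemma edge_set_subset: "edge_set T \<subseteq> touching n I"
proof clarify
  fix x y assume e: "(x, y) \<in> set (edges T)"
  then have "x \<in> set (nodes T)" "y \<in> set (nodes T)"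
    using edges_subset by blast+
  moreover have "x \<noteq> y"
    using edges_asym[OF dist e] e by auto
  moreover have "x \<in> I"
    using edges_inner_nodes[OF height_T e] by simp
  ultimately show "{x, y} \<in> touching n I"
    using nodes by (auto simp: touching_def pairs_def card_2_iff)
qed

lemma edge_rate_bounds: "0 \<le> edge_rate n a b \<sigma> e" "edge_rate n a b \<sigma> e \<le> a / n" "edge_rate n a b \<sigma> e \<le> 1"
  using ab n by (auto simp: divide_simps)

lemma set_labels: "set_pmf (uniform_labels V k) = PiE_dflt V 0 (\<lambda>_. {1..k})"
  using k by (intro set_uniform_labels) auto

lemma d_nonneg: "0 \<le> d"
  unfolding d using ab k by (intro divide_nonneg_nonneg add_nonneg_nonneg mult_nonneg_nonneg) auto

lemma affinity_W:
  assumes "\<And>x. x \<in> set (nodes T) \<Longrightarrow> \<sigma> x \<in> {1..k}"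
  shows "(\<Prod>(x, y)\<leftarrow>edges T. affinity a b (\<sigma> x) (\<sigma> y)) = d ^ L * W \<sigma>"
proof -
  have "map (\<lambda>(x, y). affinity a b (\<sigma> x) (\<sigma> y)) (edges T) =
    map (\<lambda>(x, y). d * (real k * edge_prob k \<eta> (\<sigma> x) (\<sigma> y))) (edges T)"
  proof (rule map_cong[OF refl], clarify)
    fix x y assume "(x, y) \<in> set (edges T)"
    then have "x \<in> set (nodes T)" "y \<in> set (nodes T)"
      using edges_subset by blast+
    then show "affinity a b (\<sigma> x) (\<sigma> y) = d * (real k * edge_prob k \<eta> (\<sigma> x) (\<sigma> y))"
      by (intro edge_prob_affinity[symmetric] k ab d \<eta> assms)
  qed
  then have "(\<Prod>(x, y)\<leftarrow>edges T. affinity a b (\<sigma> x) (\<sigma> y)) =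
    (\<Prod>(x, y)\<leftarrow>edges T. d * (real k * edge_prob k \<eta> (\<sigma> x) (\<sigma> y)))"
    by (rule arg_cong)
  also have "\<dots> = d ^ L * W \<sigma>"
    unfolding W_def lengths(2)[symmetric]
    by (subst prod_list_const_mult[symmetric]) (simp add: case_prod_unfold)
  finally show ?thesis .
qed

text \<open>Given the labels, edges are independent. The present ones yield the product of
  affinities over \<open>n ^ L\<close>, which \<open>affinity_W\<close> rewrites by the density
  \<open>W\<close>; the absent ones yield \<open>X\<close>.\<close>

lemma pmf_edge_set:
  assumes "\<And>x. x \<in> set (nodes T) \<Longrightarrow> \<sigma> x \<in> {1..k}"
  shows "pmf (random_subset (touching n I) (edge_rate n a b \<sigma>)) (edge_set T) = (d / n) ^ L * W \<sigma> * X \<sigma>"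
proof -
  have "(\<Prod>e\<in>edge_set T. edge_rate n a b \<sigma> e) = (\<Prod>(x, y)\<leftarrow>edges T. affinity a b (\<sigma> x) (\<sigma> y) / n)"
    unfolding prod_edge_set[OF dist] edge_rate_doubleton ..
  also have "\<dots> = (\<Prod>(x, y)\<leftarrow>edges T. (1 / n) * affinity a b (\<sigma> x) (\<sigma> y))"
    by (intro arg_cong[where f = prod_list] map_cong) auto
  also have "\<dots> = (1 / n) ^ L * (\<Prod>(x, y)\<leftarrow>edges T. affinity a b (\<sigma> x) (\<sigma> y))"
    unfolding lengths(2)[symmetric] by (subst prod_list_const_mult[symmetric]) (simp add: case_prod_unfold)
  also have "\<dots> = (1 / n) ^ L * (d ^ L * W \<sigma>)"
    using affinity_W[OF assms] by simp
  finally have "(\<Prod>e\<in>edge_set T. edge_rate n a b \<sigma> e) = (d / n) ^ L * W \<sigma>"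
    by (simp add: power_divide)
  then show ?thesis
    unfolding X_def using edge_rate_bounds
    by (subst pmf_random_subset[OF finite_touching edge_set_subset]) auto
qed

lemma W_nonneg: "0 \<le> W \<sigma>"
  unfolding W_def by (intro prod_list_nonneg) auto

text \<open>A crude bound that holds for all admissible labels, so that the mean error of
  \<open>X\<close> survives multiplication by \<open>W\<close> without any joint estimate.\<close>

lemma W_le:
  assumes "\<And>x. x \<in> set (nodes T) \<Longrightarrow> \<sigma> x \<in> {1..k}"
  shows "d ^ L * W \<sigma> \<le> a ^ L"
proof -
  have "prod_list (map (\<lambda>e. affinity a b (\<sigma> (fst e)) (\<sigma> (snd e))) es) \<le> a ^ length es" for es
    using ab by (induction es) (auto intro!: mult_mono mult_mono' prod_list_nonneg)
  from this[of "edges T"] show ?thesis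
    using affinity_W[of \<sigma>, OF assms] lengths(2) by (simp add: case_prod_unfold)
qed

text \<open>Edges of \<open>T\<close> stay within its node set, so no pair of an inner and an
  outside vertex is excluded. The index set is therefore a full product, as \<open>Z\<close>
  requires.\<close>

lemma touching_outside:
  "{e \<in> touching n I - edge_set T. \<not> e \<subseteq> set (nodes T)} = (\<lambda>(w, u). {w, u}) ` (I \<times> U)"
proof (intro equalityI subsetI)
  fix e assume e: "e \<in> {e \<in> touching n I - edge_set T. \<not> e \<subseteq> set (nodes T)}"
  then have "e \<subseteq> V" "card e = 2"
    by (auto simp: touching_def pairs_def)
  then obtain x y where xy: "e = {x, y}" "x \<in> V" "y \<in> V"
    unfolding card_2_iff by blast
  have "(x \<in> I \<and> y \<in> U) \<or> (y \<in> I \<and> x \<in> U)"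
    using e xy I_subset by (auto simp: touching_def)
  then show "e \<in> (\<lambda>(w, u). {w, u}) ` (I \<times> U)"
    unfolding xy(1) by (auto intro: image_eqI[of _ _ "(x, y)"] image_eqI[of _ _ "(y, x)"])
next
  fix e assume "e \<in> (\<lambda>(w, u). {w, u}) ` (I \<times> U)"
  then obtain w u where e: "e = {w, u}" and w: "w \<in> I" and u: "u \<in> V" "u \<notin> set (nodes T)"
    by auto
  have "w \<noteq> u"
    using w u I_subset by blast
  then have "e \<in> touching n I"
    using w u I_subset nodes by (auto simp: e touching_def pairs_def)
  moreover have "e \<notin> edge_set T"
    using u edges_subset[of T] by (auto simp: e doubleton_eq_iff)
  ultimately show "e \<in> {e \<in> touching n I - edge_set T. \<not> e \<subseteq> set (nodes T)}"
    using u e by auto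
qed

lemma X_Z:
  "X \<sigma> = (\<Prod>e\<in>{e \<in> touching n I - edge_set T. e \<subseteq> set (nodes T)}. 1 - edge_rate n a b \<sigma> e) * Z \<sigma>"
proof -
  let ?Q = "touching n I - edge_set T"
  let ?Q1 = "{e \<in> ?Q. e \<subseteq> set (nodes T)}" and ?Q2 = "{e \<in> ?Q. \<not> e \<subseteq> set (nodes T)}"
  have fin: "finite ?Q1" "finite ?Q2"
    using finite_touching by auto
  have "X \<sigma> = (\<Prod>e\<in>?Q1 \<union> ?Q2. 1 - edge_rate n a b \<sigma> e)"
    unfolding X_def by (intro prod.cong) auto
  also have "\<dots> = (\<Prod>e\<in>?Q1. 1 - edge_rate n a b \<sigma> e) * (\<Prod>e\<in>?Q2. 1 - edge_rate n a b \<sigma> e)"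
    using fin by (intro prod.union_disjoint) auto
  also have "(\<Prod>e\<in>?Q2. 1 - edge_rate n a b \<sigma> e) = (\<Prod>(w, u)\<in>I \<times> U. 1 - affinity a b (\<sigma> w) (\<sigma> u) / n)"
  proof -
    have "inj_on (\<lambda>(w, u). {w, u}) (I \<times> U)"
      using I_subset by (auto simp: inj_on_def doubleton_eq_iff)
    then have "(\<Prod>e\<in>?Q2. 1 - edge_rate n a b \<sigma> e) =
        (\<Prod>p\<in>I \<times> U. 1 - edge_rate n a b \<sigma> (case p of (w, u) \<Rightarrow> {w, u}))"
      unfolding touching_outside by (subst prod.reindex) (simp_all only: comp_def)
    also have "\<dots> = (\<Prod>(w, u)\<in>I \<times> U. 1 - affinity a b (\<sigma> w) (\<sigma> u) / n)"
      by (rule prod.cong[OF refl], clarify) (simp only: prod.case edge_rate_doubleton)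
    finally show ?thesis .
  qed
  also have "\<dots> = Z \<sigma>"
    unfolding Z_def by (subst prod.swap) (simp add: prod.cartesian_product)
  finally show ?thesis .
qed

lemma abs_X_diff_le: "\<bar>X \<sigma> - c\<bar> \<le> \<bar>Z \<sigma> - c\<bar> + (1 - (1 - a / n) ^ (2 ^ length (nodes t)))"
proof -
  let ?Q1 = "{e \<in> touching n I - edge_set T. e \<subseteq> set (nodes T)}"
  let ?P = "\<Prod>e\<in>?Q1. 1 - edge_rate n a b \<sigma> e"
  have a: "0 \<le> 1 - a / n" "1 - a / n \<le> 1"
    using ab n by (auto simp: divide_simps)
  have Z: "0 \<le> Z \<sigma>" "Z \<sigma> \<le> 1"
  proof -
    have "0 \<le> 1 - affinity a b (\<sigma> w) (\<sigma> u) / n \<and> 1 - affinity a b (\<sigma> w) (\<sigma> u) / n \<le> 1" for u w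
      using ab n by (auto simp: divide_simps)
    then show "0 \<le> Z \<sigma>" "Z \<sigma> \<le> 1"
      unfolding Z_def by (auto intro!: prod_nonneg prod_le_1)
  qed
  have P: "?P \<le> 1" "0 \<le> ?P"
    using edge_rate_bounds by (intro prod_le_1 prod_nonneg; simp)+
  \<comment> \<open>The pairs are counted as subsets of the node set. The resulting exponent is
    large, but fixed with the shape.\<close>
  have "card ?Q1 \<le> card (Pow (set (nodes T)))"
    by (intro card_mono) auto
  also have "\<dots> = 2 ^ length (nodes t)"
    by (simp add: card_Pow distinct_card[OF dist] lengths)
  finally have "(1 - a / n) ^ (2 ^ length (nodes t)) \<le> (1 - a / n) ^ card ?Q1"
    using a by (intro power_decreasing)
  also have "\<dots> = (\<Prod>e\<in>?Q1. 1 - a / n)"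
    by simp
  also have "\<dots> \<le> ?P"
    using a edge_rate_bounds(2) by (intro prod_mono) auto
  finally have "1 - ?P \<le> 1 - (1 - a / n) ^ (2 ^ length (nodes t))"
    by simp
  moreover have "\<bar>X \<sigma> - Z \<sigma>\<bar> = (1 - ?P) * Z \<sigma>"
  proof -
    have "X \<sigma> - Z \<sigma> = - ((1 - ?P) * Z \<sigma>)"
      unfolding X_Z by (simp add: algebra_simps)
    moreover have "0 \<le> (1 - ?P) * Z \<sigma>"
      using P Z by (intro mult_nonneg_nonneg) auto
    ultimately show ?thesis by linarith
  qed
  moreover have "(1 - ?P) * Z \<sigma> \<le> 1 - ?P"
    using P Z by (intro mult_left_le) auto
  ultimately show ?thesis
    by linarith
qed

lemma V_eq: "V = set (nodes T) \<union> U" "V = U \<union> set (nodes T)"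
  using nodes by auto

lemma finite_labels: "finite (set_pmf (uniform_labels V k))"
  using k by (intro finite_set_uniform_labels) auto

text \<open>The labels of the tree are frozen first. Then \<open>concentration_prod\<close> applies
  to the labels outside, with a bound that is the same for all frozen labels.\<close>

lemma expectation_X: "measure_pmf.expectation (uniform_labels V k) (\<lambda>\<sigma>. \<bar>X \<sigma> - c\<bar>) \<le> err"
proof -
  let ?\<delta> = "1 - (1 - a / n) ^ (2 ^ length (nodes t))"
  let ?s = "sqrt (concentration_err a d (length (inner_nodes r t)) (length (nodes t)) n)"
  let ?A = "set (nodes T)"
  have "measure_pmf.expectation (uniform_labels V k) (\<lambda>\<sigma>. \<bar>X \<sigma> - c\<bar>) \<le>
    measure_pmf.expectation (uniform_labels V k) (\<lambda>\<sigma>. \<bar>Z \<sigma> - c\<bar> + ?\<delta>)"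
    by (intro expectation_mono_finite finite_labels abs_X_diff_le)
  also have "\<dots> = measure_pmf.expectation (uniform_labels V k) (\<lambda>\<sigma>. \<bar>Z \<sigma> - c\<bar>) + ?\<delta>"
    by (simp add: integrable_measure_pmf_finite[OF finite_labels] del: One_nat_def)
  also have "measure_pmf.expectation (uniform_labels V k) (\<lambda>\<sigma>. \<bar>Z \<sigma> - c\<bar>) =
    measure_pmf.expectation (uniform_labels ?A k) (\<lambda>f.
      measure_pmf.expectation (uniform_labels U k) (\<lambda>g. \<bar>Z (\<lambda>x. if x \<in> ?A then f x else g x) - c\<bar>))"
    by (subst V_eq(1), rule expectation_uniform_labels_union) (use k in auto)
  also have "\<dots> \<le> measure_pmf.expectation (uniform_labels ?A k) (\<lambda>f. ?s)"
  proof (intro expectation_mono_finite)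
    show "finite (set_pmf (uniform_labels ?A k))"
      using k by (intro finite_set_uniform_labels) auto
    fix f assume "f \<in> set_pmf (uniform_labels ?A k)"
    then have f: "f x \<in> {1..k}" if "x \<in> I" for x
      using that I_subset k unfolding set_uniform_labels[OF finite_set k] by (auto simp: PiE_dflt_def)
    have "Z (\<lambda>x. if x \<in> ?A then f x else g x) = (\<Prod>u\<in>U. \<Prod>w\<in>I. 1 - affinity a b (f w) (g u) / n)" for g
      unfolding Z_def using I_subset by (intro prod.cong refl) auto
    moreover have "card U + length (nodes t) = n"
    proof -
      have "card V = card ?A + card U"
        using V_eq(1) by (metis Diff_disjoint List.finite_set card_Un_disjoint finite_Diff finite_atLeastAtMost)
      then show ?thesis
        by (simp add: distinct_card[OF dist] lengths)
    qed
    moreover have "real (card I) * d \<le> real n"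
    proof -
      have "card I \<le> length (nodes t)"
        using card_mono[OF _ I_subset] by (simp add: distinct_card[OF dist] lengths)
      then have "real (card I) * d \<le> real (length (nodes t)) * d"
        using d_nonneg by (intro mult_right_mono) auto
      with n show ?thesis by linarith
    qed
    moreover have "finite U" "finite I" "b \<le> a"
      using ab by auto
    ultimately show "measure_pmf.expectation (uniform_labels U k)
        (\<lambda>g. \<bar>Z (\<lambda>x. if x \<in> ?A then f x else g x) - c\<bar>) \<le> ?s"
      using concentration_prod[OF _ _ f k ab(1) _ n(1,2) _ _ d, where U = U and W = I and N = "length (nodes t)"]
      unfolding c_def card_I by simp
  qed
  finally show ?thesis
    by (simp add: embedding_err_def)
qed

lemma err_nonneg: "0 \<le> err"
proof -
  have "0 \<le> measure_pmf.expectation (uniform_labels V k) (\<lambda>\<sigma>. \<bar>X \<sigma> - c\<bar>)"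
    by (rule Bochner_Integration.integral_nonneg) simp
  with expectation_X show ?thesis by linarith
qed

lemma expectation_W: "measure_pmf.expectation (uniform_labels V k) W = 1"
proof -
  have "0 \<le> \<eta>"
    unfolding \<eta> using ab k by (intro divide_nonneg_nonneg add_nonneg_nonneg mult_nonneg_nonneg) auto
  then show ?thesis
    using expectation_broadcast_conv_uniform_labels[OF _ nodes dist k, of \<eta> "\<lambda>_. 1"]
    by (simp add: W_def[abs_def] del: One_nat_def)
qed

text \<open>Once the labels outside the tree are frozen, \<open>\<Phi>\<close> depends only on the
  labels of generation \<open>r\<close>. The change of measure by \<open>W\<close> turns the
  expectation into one for the broadcast process, where duality bounds it by the deviation of the
  root posterior.\<close>

lemma expectation_W_posterior:
  assumes \<Phi>: "\<And>\<sigma> \<sigma>'. (\<And>x. x \<notin> I \<Longrightarrow> \<sigma> x = \<sigma>' x) \<Longrightarrow> \<Phi> \<sigma> = \<Phi> \<sigma>'" "\<And>\<sigma>. \<bar>\<Phi> \<sigma>\<bar> \<le> 1"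
  shows "\<bar>measure_pmf.expectation (uniform_labels V k) (\<lambda>\<sigma>. (of_bool (\<sigma> v = i) - 1 / k) * W \<sigma> * \<Phi> \<sigma>)\<bar> \<le>
    measure_pmf.expectation (broadcast k \<eta> t) (\<lambda>\<tau>. \<bar>root_posterior k \<eta> r i t \<tau> - 1 / k\<bar>)"
    (is "_ \<le> ?N")
proof -
  let ?A = "set (nodes T)"
  let ?h = "\<lambda>s. of_bool (s = i) - 1 / k :: real"
  have "0 \<le> \<eta>"
    unfolding \<eta> using ab k by (intro divide_nonneg_nonneg add_nonneg_nonneg mult_nonneg_nonneg) auto
  then have fin_bc: "finite (set_pmf (broadcast k \<eta> t))"
    using set_broadcast[OF k] finite_labelings by (meson finite_subset)
  have inner: "\<bar>measure_pmf.expectation (uniform_labels ?A k) (\<lambda>f.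
      ?h (merge f v) * W (merge f) * \<Phi> (merge f))\<bar> \<le> ?N"
    if merge: "merge = (\<lambda>f x. if x \<in> U then g x else f x)" for g and merge :: "(nat \<Rightarrow> nat) \<Rightarrow> nat \<Rightarrow> nat"
  proof -
    \<comment> \<open>The labelling is rebuilt from the list of labels in generation
      \<open>r\<close>. Inner vertices get the dummy label 0, which is harmless since
      \<open>\<Phi>\<close> ignores them.\<close>
    define \<phi> where "\<phi> = (\<lambda>ls. \<Phi> (\<lambda>x. if x \<in> U then g x else
        if x \<in> set (level r T) then the (map_of (zip (level r T) ls) x) else 0))"
    have level: "distinct (level r T)"
      using distinct_inner_level by simp
    have "?h (merge f v) * W (merge f) * \<Phi> (merge f) =
      W f * (?h (root (map_rtree f T)) * \<phi> (level r (map_rtree f T)))"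
      if f: "f \<in> set_pmf (uniform_labels ?A k)" for f
    proof -
      \<comment> \<open>Outside the node set a sample takes the default value 0 of
        \<open>Pi_pmf\<close>, in agreement with the last branch of \<open>\<phi>\<close>.\<close>
      have f0: "f x = 0" if "x \<notin> ?A" for x
        using that f k unfolding set_uniform_labels[OF finite_set k] by (auto simp: PiE_dflt_def)
      have "merge f v = root (map_rtree f T)"
        using v_in root by (auto simp: merge)
      moreover have "W (merge f) = W f"
      proof -
        have "map (\<lambda>(x, y). real k * edge_prob k \<eta> (merge f x) (merge f y)) (edges T) =
          map (\<lambda>(x, y). real k * edge_prob k \<eta> (f x) (f y)) (edges T)"
          using edges_subset[of T] by (intro map_cong refl) (auto simp: merge)
        then show ?thesis
          unfolding W_def by (rule arg_cong)
      qed
      moreover have "\<Phi> (merge f) = \<phi> (level r (map_rtree f T))"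
        unfolding \<phi>_def
      proof (rule \<Phi>(1))
        fix x assume x: "x \<notin> I"
        consider "x \<in> U" | "x \<notin> U" "x \<in> set (level r T)" | "x \<notin> U" "x \<notin> ?A"
          using x set_inner_level by blast
        then show "merge f x = (if x \<in> U then g x else if x \<in> set (level r T)
            then the (map_of (zip (level r T) (level r (map_rtree f T))) x) else 0)"
        proof cases
          case 2
          then have "map_of (zip (level r T) (map f (level r T))) x = Some (f x)"
            by (simp add: map_of_zip_map)
          moreover have "merge f x = f x"
            unfolding merge using 2(1) by (rule if_not_P)
          ultimately show ?thesis
            unfolding level_map_rtree by (simp only: 2 if_False if_True option.sel)
        next
          case 3
          then have "x \<notin> set (level r T)"
            using set_inner_level by blast
          moreover have "merge f x = f x"
            unfolding merge using 3(1) by (rule if_not_P)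
          ultimately show ?thesis
            by (simp only: 3 f0[OF 3(2)] if_False)
        qed (simp add: merge)
      qed
      ultimately show ?thesis
        by simp
    qed
    then have "measure_pmf.expectation (uniform_labels ?A k) (\<lambda>f. ?h (merge f v) * W (merge f) * \<Phi> (merge f)) =
      measure_pmf.expectation (uniform_labels ?A k) (\<lambda>f. W f * (?h (root (map_rtree f T)) * \<phi> (level r (map_rtree f T))))"
      by (intro integral_cong_AE AE_pmfI) auto
    also have "\<dots> = measure_pmf.expectation (broadcast k \<eta> t) (\<lambda>\<tau>. ?h (root \<tau>) * \<phi> (level r \<tau>))"
      unfolding W_def using expectation_broadcast_conv_uniform_labels[OF _ order.refl dist k \<open>0 \<le> \<eta>\<close>,
        of "\<lambda>\<tau>. ?h (root \<tau>) * \<phi> (level r \<tau>)"] by (simp add: shape del: One_nat_def)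
    finally show ?thesis
      unfolding root_posterior_def
      using expectation_diff_le_posterior[OF fin_bc, of \<phi> "\<lambda>\<tau>. root \<tau> = i" "1 / k" "level r"] \<Phi>(2)
      by (simp add: \<phi>_def)
  qed
  have eq: "measure_pmf.expectation (uniform_labels V k) (\<lambda>\<sigma>. ?h (\<sigma> v) * W \<sigma> * \<Phi> \<sigma>) =
    measure_pmf.expectation (uniform_labels U k) (\<lambda>g. measure_pmf.expectation (uniform_labels ?A k) (\<lambda>f.
      ?h (if v \<in> U then g v else f v) * W (\<lambda>x. if x \<in> U then g x else f x) * \<Phi> (\<lambda>x. if x \<in> U then g x else f x)))"
    by (subst V_eq(2), rule expectation_uniform_labels_union) (use k in auto)
  have "\<bar>measure_pmf.expectation (uniform_labels U k) (\<lambda>g. measure_pmf.expectation (uniform_labels ?A k) (\<lambda>f.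
      ?h (if v \<in> U then g v else f v) * W (\<lambda>x. if x \<in> U then g x else f x) * \<Phi> (\<lambda>x. if x \<in> U then g x else f x)))\<bar>
    \<le> measure_pmf.expectation (uniform_labels U k) (\<lambda>g. ?N)"
    using inner[OF refl] k by (intro abs_expectation_le finite_set_uniform_labels) auto
  then show ?thesis
    unfolding eq by simp
qed

lemma expectation_uniform_labels_cong_le:
  fixes F G :: "(nat \<Rightarrow> nat) \<Rightarrow> real"
  assumes "\<And>\<sigma>. (\<And>x. x \<in> set (nodes T) \<Longrightarrow> \<sigma> x \<in> {1..k}) \<Longrightarrow> \<bar>F \<sigma> - G \<sigma>\<bar> \<le> (a / n) ^ L * \<bar>X \<sigma> - c\<bar>"
  shows "\<bar>measure_pmf.expectation (uniform_labels V k) F - measure_pmf.expectation (uniform_labels V k) G\<bar> \<le>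
    (a / n) ^ L * err"
proof -
  note int = integrable_measure_pmf_finite[OF finite_labels]
  have "measure_pmf.expectation (uniform_labels V k) F - measure_pmf.expectation (uniform_labels V k) G =
    measure_pmf.expectation (uniform_labels V k) (\<lambda>\<sigma>. F \<sigma> - G \<sigma>)"
    by (rule Bochner_Integration.integral_diff[OF int int, symmetric])
  moreover have "\<bar>measure_pmf.expectation (uniform_labels V k) (\<lambda>\<sigma>. F \<sigma> - G \<sigma>)\<bar> \<le>
    measure_pmf.expectation (uniform_labels V k) (\<lambda>\<sigma>. (a / n) ^ L * \<bar>X \<sigma> - c\<bar>)"
  proof (intro abs_expectation_le finite_labels assms)
    fix \<sigma> x assume "\<sigma> \<in> set_pmf (uniform_labels V k)" "x \<in> set (nodes T)"
    then show "\<sigma> x \<in> {1..k}"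
      using nodes unfolding set_labels PiE_dflt_def by blast
  qed
  moreover have "measure_pmf.expectation (uniform_labels V k) (\<lambda>\<sigma>. (a / n) ^ L * \<bar>X \<sigma> - c\<bar>) \<le> (a / n) ^ L * err"
    using expectation_X ab by (simp add: mult_left_mono del: One_nat_def)
  ultimately show ?thesis
    by linarith
qed

text \<open>The factor \<open>y\<close> stands for whatever bounded quantity accompanies the edge
  probability: the centred label indicator times the averaged test function, or a power of
  \<open>1 - p\<close>.\<close>

lemma pmf_edge_set_approx:
  assumes "\<And>x. x \<in> set (nodes T) \<Longrightarrow> \<sigma> x \<in> {1..k}" "\<bar>y\<bar> \<le> 1"
  shows "\<bar>y * pmf (random_subset (touching n I) (edge_rate n a b \<sigma>)) (edge_set T) -
    (d / n) ^ L * c * (y * W \<sigma>)\<bar> \<le> (a / n) ^ L * \<bar>X \<sigma> - c\<bar>"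
proof -
  have "y * pmf (random_subset (touching n I) (edge_rate n a b \<sigma>)) (edge_set T) - (d / n) ^ L * c * (y * W \<sigma>) =
      y * ((d / n) ^ L * W \<sigma>) * (X \<sigma> - c)"
    by (simp add: pmf_edge_set[of \<sigma>, OF assms(1)] algebra_simps)
  also have "\<bar>\<dots>\<bar> = \<bar>y\<bar> * ((d / n) ^ L * W \<sigma>) * \<bar>X \<sigma> - c\<bar>"
    using d_nonneg W_nonneg by (simp add: abs_mult)
  also have "\<dots> \<le> 1 * ((a / n) ^ L) * \<bar>X \<sigma> - c\<bar>"
  proof (intro mult_right_mono mult_mono)
    show "(d / n) ^ L * W \<sigma> \<le> (a / n) ^ L"
      using W_le[OF assms(1)] n by (simp add: power_divide divide_right_mono)
  qed (use assms(2) d_nonneg W_nonneg in auto)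
  finally show ?thesis by simp
qed

text \<open>Replacing \<open>X\<close> by \<open>c\<close> costs the error term. What remains is the
  density \<open>W\<close> against a function that ignores the inner labels.\<close>

lemma posterior_bound:
  assumes f: "\<And>y. \<bar>f y\<bar> \<le> 1" and i: "i \<in> {1..k}"
  shows "\<bar>measure_pmf.expectation (labeled_sbm n k a b p) (\<lambda>(G, R, \<sigma>).
      of_bool (explored r G T) * of_bool (R \<inter> I = {}) * ((of_bool (\<sigma> v = i) - 1 / k) * f (G, R, restrict \<sigma> R)))\<bar>
    \<le> (d / n) ^ L * c * measure_pmf.expectation (broadcast k \<eta> t) (\<lambda>\<tau>. \<bar>root_posterior k \<eta> r i t \<tau> - 1 / k\<bar>) +
      (a / n) ^ L * err" (is "\<bar>?lhs\<bar> \<le> _ * ?N + _")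
proof -
  let ?h = "\<lambda>s. of_bool (s = i) - 1 / k :: real"
  let ?\<Phi> = "unrevealed_avg n a b p r T f"
  let ?M = "uniform_labels V k"
  let ?F = "\<lambda>\<sigma>. ?h (\<sigma> v) * pmf (random_subset (touching n I) (edge_rate n a b \<sigma>)) (edge_set T) * ?\<Phi> \<sigma>"
  let ?G = "\<lambda>\<sigma>. (d / n) ^ L * c * (?h (\<sigma> v) * W \<sigma> * ?\<Phi> \<sigma>)"
  have lhs: "?lhs = measure_pmf.expectation ?M ?F"
    by (rule expectation_labeled_sbm_explored[OF k])
  have "\<bar>measure_pmf.expectation ?M ?F - measure_pmf.expectation ?M ?G\<bar> \<le> (a / n) ^ L * err"
  proof (rule expectation_uniform_labels_cong_le)
    fix \<sigma> assume \<sigma>: "\<And>x. x \<in> set (nodes T) \<Longrightarrow> \<sigma> x \<in> {1..k}"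
    have "\<bar>?h (\<sigma> v)\<bar> \<le> 1"
      using k by (auto simp: of_bool_def divide_simps)
    moreover have "\<bar>?\<Phi> \<sigma>\<bar> \<le> 1"
      by (rule abs_unrevealed_avg_le) (rule f)
    ultimately have "\<bar>?h (\<sigma> v) * ?\<Phi> \<sigma>\<bar> \<le> 1"
      unfolding abs_mult by (intro mult_le_one) auto
    from pmf_edge_set_approx[of \<sigma>, OF \<sigma> this] show "\<bar>?F \<sigma> - ?G \<sigma>\<bar> \<le> (a / n) ^ L * \<bar>X \<sigma> - c\<bar>"
      by (simp only: mult_ac)
  qed
  moreover have "\<bar>measure_pmf.expectation ?M ?G\<bar> =
      (d / n) ^ L * c * \<bar>measure_pmf.expectation ?M (\<lambda>\<sigma>. ?h (\<sigma> v) * W \<sigma> * ?\<Phi> \<sigma>)\<bar>"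
    using d_nonneg by (simp add: abs_mult c_def del: One_nat_def)
  moreover have "(d / n) ^ L * c * \<bar>measure_pmf.expectation ?M (\<lambda>\<sigma>. ?h (\<sigma> v) * W \<sigma> * ?\<Phi> \<sigma>)\<bar> \<le> (d / n) ^ L * c * ?N"
  proof (rule mult_left_mono)
    show "\<bar>measure_pmf.expectation ?M (\<lambda>\<sigma>. ?h (\<sigma> v) * W \<sigma> * ?\<Phi> \<sigma>)\<bar> \<le> ?N"
    proof (rule expectation_W_posterior)
      show "?\<Phi> \<sigma> = ?\<Phi> \<sigma>'" if "\<And>x. x \<notin> I \<Longrightarrow> \<sigma> x = \<sigma>' x" for \<sigma> \<sigma>'
        by (rule unrevealed_avg_cong) (rule that)
      show "\<bar>?\<Phi> \<sigma>\<bar> \<le> 1" for \<sigma>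
        by (rule abs_unrevealed_avg_le) (rule f)
    qed
    show "0 \<le> (d / n) ^ L * c"
      using d_nonneg by (simp add: c_def)
  qed
  ultimately show ?thesis
    unfolding lhs by linarith
qed

text \<open>The same approximation with test function and label factor equal to 1; here the density
  \<open>W\<close> simply integrates to 1.\<close>

lemma explored_probability:
  assumes p: "0 \<le> p" "p \<le> 1"
  shows "measure_pmf.expectation (labeled_sbm n k a b p) (\<lambda>(G, R, \<sigma>).
      of_bool (explored r G T) * of_bool (R \<inter> I = {})) \<ge>
    (d / n) ^ L * c * (1 - p) ^ length (inner_nodes r t) - (a / n) ^ L * err" (is "?lhs \<ge> _")
proof -
  let ?M = "uniform_labels V k"
  let ?y = "(1 - p) ^ length (inner_nodes r t)"
  let ?F = "\<lambda>\<sigma>. ?y * pmf (random_subset (touching n I) (edge_rate n a b \<sigma>)) (edge_set T)"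
  let ?G = "\<lambda>\<sigma>. (d / n) ^ L * c * (?y * W \<sigma>)"
  have \<Phi>: "unrevealed_avg n a b p r T (\<lambda>_. 1) \<sigma> = ?y" for \<sigma>
    using unrevealed_avg_1[OF p, of r T n] I_subset nodes unfolding card_I by blast
  have "?lhs = measure_pmf.expectation ?M ?F"
    using expectation_labeled_sbm_explored[OF k, of n a b p r T "\<lambda>_. 1" v "\<lambda>_. 1"]
    unfolding \<Phi> by (simp add: mult.commute del: One_nat_def)
  moreover have "\<bar>measure_pmf.expectation ?M ?F - measure_pmf.expectation ?M ?G\<bar> \<le> (a / n) ^ L * err"
    using p by (intro expectation_uniform_labels_cong_le pmf_edge_set_approx) (auto intro: power_le_one)
  moreover have "measure_pmf.expectation ?M ?G = (d / n) ^ L * c * ?y"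
    using expectation_W by (simp del: One_nat_def)
  ultimately show ?thesis
    by linarith
qed

end

section \<open>Passing to the limit\<close>

definition root_information :: "nat \<Rightarrow> real \<Rightarrow> nat \<Rightarrow> nat \<Rightarrow> unit rtree \<Rightarrow> real" where
  "root_information k \<eta> r i t =
     measure_pmf.expectation (broadcast k \<eta> t) (\<lambda>\<tau>. \<bar>root_posterior k \<eta> r i t \<tau> - 1 / k\<bar>)"

text \<open>Embeddings of different shapes are different trees, so the double sum runs over distinct
  explored trees and the bound for a single random exploration applies, pointwise in
  \<open>G\<close> and \<open>R\<close>.\<close>

lemma sum_weight_embeddings_le_1:
  assumes "finite S" "\<And>t. t \<in> S \<Longrightarrow> height_le r t" "G \<subseteq> pairs n"
  shows "(\<Sum>t\<in>S. \<Sum>T\<in>embeddings n v t. weight t *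
      (of_bool (explored r G T) * of_bool (R \<inter> set (inner_nodes r T) = {}))) \<le> 1"
proof -
  let ?E = "\<Union>t\<in>S. embeddings n v t"
  let ?\<T> = "{T \<in> ?E. explored r G T}"
  have fin: "finite ?E"
    using assms(1) finite_embeddings by auto
  have weight: "weight T = weight t" if "T \<in> embeddings n v t" for T t
    using that weight_map_rtree[of "\<lambda>_. ()" T] by (simp add: embeddings_def)
  have "(\<Sum>t\<in>S. \<Sum>T\<in>embeddings n v t. weight t *
      (of_bool (explored r G T) * of_bool (R \<inter> set (inner_nodes r T) = {}))) \<le>
    (\<Sum>t\<in>S. \<Sum>T\<in>embeddings n v t. weight T * of_bool (explored r G T))"
    by (intro sum_mono) (auto simp: weight weight_nonneg)
  also have "\<dots> = (\<Sum>T\<in>?E. weight T * of_bool (explored r G T))"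
    by (rule sum.UNION_disjoint[symmetric]) (use assms(1) finite_embeddings in \<open>auto simp: embeddings_def\<close>)
  also have "\<dots> = (\<Sum>T\<in>?\<T>. weight T)"
    using fin by (intro sum.mono_neutral_cong_right) auto
  also have "\<dots> \<le> 1"
  proof (rule sum_weight_explored_le_1[OF assms(3)])
    show "height_le r T \<and> distinct (nodes T) \<and> root T = v \<and> explored r G T" if "T \<in> ?\<T>" for T
      using that assms(2)[of "shape T"] by (auto simp: embeddings_def)
    show "finite ?\<T>"
      using fin by (rule rev_finite_subset) auto
  qed
  finally show ?thesis .
qed

text \<open>The tested quantity \<open>x\<close> is split as \<open>x * g + x * (1 - g)\<close>,
  where \<open>g\<close> is the weight of the explored trees with unrevealed inner vertices. The
  first part is estimated embedding by embedding; the second is at most the mass that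
  \<open>g\<close> misses.\<close>

lemma sbm_posterior_deviation_le:
  fixes a b d \<eta> p :: real
  assumes k: "k \<ge> 1" and ab: "0 \<le> b" "b < a" and p: "0 \<le> p" "p \<le> 1"
    and d: "d = (a + (real k - 1) * b) / real k" and \<eta>: "\<eta> = b / (a + (real k - 1) * b)"
    and S: "finite S" "\<And>t. t \<in> S \<Longrightarrow> height_le r t" and v: "v \<in> {1..n}" and i: "i \<in> {1..k}"
    and n: "a \<le> real n" "\<And>t. t \<in> S \<Longrightarrow> real (length (nodes t)) * d \<le> real n" "\<And>t. t \<in> S \<Longrightarrow> length (nodes t) < n"
  shows "measure_pmf.expectation (labeled_sbm n k a b p) (\<lambda>\<omega>. \<bar>sbm_posterior n k a b p v i \<omega> - 1 / k\<bar>) \<le>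
    1 - (\<Sum>t\<in>S. (1 - length (nodes t) / n) ^ length (edges t) *
          (pmf (gw_tree (poisson_pmf d) r) t * (1 - p) ^ length (inner_nodes r t))) +
      (\<Sum>t\<in>S. pmf (gw_tree (poisson_pmf d) r) t * root_information k \<eta> r i t) +
      (\<Sum>t\<in>S. 2 * weight t * a ^ length (edges t) * embedding_err r a d t n)"
  unfolding sbm_posterior_def
proof (rule expectation_posterior_le[OF finite_set_labeled_sbm[OF k]])
  fix f :: "nat set set \<times> nat set \<times> (nat \<Rightarrow> nat) \<Rightarrow> real"
  assume f: "\<And>y. \<bar>f y\<bar> \<le> 1"
  let ?M = "labeled_sbm n k a b p"
  let ?h = "\<lambda>s. of_bool (s = i) - 1 / k :: real"
  let ?x = "\<lambda>\<sigma>::nat\<Rightarrow>nat. \<lambda>G R. ?h (\<sigma> v) * f (G, R, restrict \<sigma> R)"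
  let ?e = "\<lambda>T G R. of_bool (explored r G T) * of_bool (R \<inter> set (inner_nodes r T) = {}) :: real"
  let ?gw = "pmf (gw_tree (poisson_pmf d) r)"
  let ?L = "\<lambda>t::unit rtree. length (edges t)" and ?m = "\<lambda>t::unit rtree. length (inner_nodes r t)"
  let ?c = "\<lambda>t. exp (- (real (?m t) * d))"
  let ?err = "\<lambda>t. embedding_err r a d t n"
  let ?N = "root_information k \<eta> r i"
  have n0: "n > 0"
    using v by auto
  have d0: "d > 0"
    unfolding d using ab k by (intro divide_pos_pos add_pos_nonneg mult_nonneg_nonneg) auto
  note int = integrable_measure_pmf_finite[OF finite_set_labeled_sbm[OF k]]
  define g where "g = (\<lambda>(G, R, \<sigma>::nat\<Rightarrow>nat). \<Sum>t\<in>S. \<Sum>T\<in>embeddings n v t. weight t * ?e T G R)"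
  define x where "x = (\<lambda>(G, R, \<sigma>). ?x \<sigma> G R)"
  have loc: "sbm_embedding n k r v a b d \<eta> t T" if "t \<in> S" "T \<in> embeddings n v t" for t T
    using that k ab d \<eta> S n n0 by unfold_locales auto
  \<comment> \<open>Here the Galton-Watson law enters: the likelihood of an embedding, cleared of
    its powers of \<open>n\<close> and multiplied by the weight, is the probability of the
    shape.\<close>
  have gw: "?gw t = ?c t * d ^ ?L t * weight t" if "t \<in> S" for t
    using pmf_gw_tree[OF d0 S(2)[OF that]] by (simp add: exp_of_nat_mult[symmetric])
  have N0: "0 \<le> ?N t" for t
    unfolding root_information_def by (intro Bochner_Integration.integral_nonneg) auto
  have card_le: "real (card (embeddings n v t)) / n ^ ?L t \<le> 1" if "t \<in> S" for t
  proof -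
    have "real (card (embeddings n v t)) \<le> real (n ^ ?L t)"
      using card_embeddings(1)[OF v less_imp_le[OF n(3)[OF that]]] by (simp only: of_nat_le_iff)
    then show ?thesis
      using n0 by simp
  qed
  have card_ge: "(1 - length (nodes t) / n) ^ ?L t \<le> real (card (embeddings n v t)) / n ^ ?L t" if "t \<in> S" for t
  proof -
    have "real ((n - length (nodes t)) ^ ?L t) \<le> real (card (embeddings n v t))"
      using card_embeddings(2)[OF v less_imp_le[OF n(3)[OF that]]] by (simp only: of_nat_le_iff)
    moreover have "(1 - length (nodes t) / n) ^ ?L t = real ((n - length (nodes t)) ^ ?L t) / n ^ ?L t"
      using n(3)[OF that] n0 by (simp add: of_nat_diff power_divide[symmetric] diff_divide_distrib)
    ultimately show ?thesis
      by (simp add: divide_right_mono)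
  qed
  \<comment> \<open>In the locale the sign follows from an expectation, so some embedding has to
    exist; this is where the strict inequality \<open>length (nodes t) < n\<close> enters.\<close>
  have err_nonneg: "0 \<le> ?err t" if t: "t \<in> S" for t
  proof -
    have "0 < (n - length (nodes t)) ^ ?L t"
      using n(3)[OF t] by simp
    also have "\<dots> \<le> card (embeddings n v t)"
      by (rule card_embeddings(2)[OF v less_imp_le[OF n(3)[OF t]]])
    finally obtain T where "T \<in> embeddings n v t"
      by (auto simp: card_gt_0_iff)
    then show ?thesis
      using sbm_embedding.err_nonneg[OF loc[OF t]] by blast
  qed
  have main: "measure_pmf.expectation ?M (\<lambda>\<omega>. x \<omega> * g \<omega>) \<le>
    (\<Sum>t\<in>S. ?gw t * ?N t + weight t * a ^ ?L t * ?err t)"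
  proof -
    have "measure_pmf.expectation ?M (\<lambda>\<omega>. x \<omega> * g \<omega>) =
        (\<Sum>t\<in>S. \<Sum>T\<in>embeddings n v t. weight t * measure_pmf.expectation ?M (\<lambda>(G, R, \<sigma>). ?e T G R * ?x \<sigma> G R))"
    proof -
      have "x \<omega> * g \<omega> = (\<Sum>t\<in>S. \<Sum>T\<in>embeddings n v t. weight t * (case \<omega> of (G, R, \<sigma>) \<Rightarrow> ?e T G R * ?x \<sigma> G R))" for \<omega>
        by (cases \<omega>) (simp add: x_def g_def sum_distrib_left mult_ac)
      then show ?thesis
        by (simp add: int)
    qed
    also have "\<dots> \<le> (\<Sum>t\<in>S. ?gw t * ?N t + weight t * a ^ ?L t * ?err t)"
    proof (rule sum_mono)
      fix t assume t: "t \<in> S"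
      let ?b = "d ^ ?L t * ?c t * ?N t + a ^ ?L t * ?err t"
      have "measure_pmf.expectation ?M (\<lambda>(G, R, \<sigma>). ?e T G R * ?x \<sigma> G R) \<le> ?b / n ^ ?L t"
        if T: "T \<in> embeddings n v t" for T
        using sbm_embedding.posterior_bound[OF loc[OF t T], of f i p] f i
        unfolding sbm_embedding.c_def[OF loc[OF t T]] root_information_def
        by (simp add: power_divide add_divide_distrib)
      then have "(\<Sum>T\<in>embeddings n v t. weight t * measure_pmf.expectation ?M (\<lambda>(G, R, \<sigma>). ?e T G R * ?x \<sigma> G R)) \<le>
          (\<Sum>T\<in>embeddings n v t. weight t * (?b / n ^ ?L t))"
        by (intro sum_mono mult_left_mono weight_nonneg)
      also have "\<dots> = (weight t * ?b) * (card (embeddings n v t) / n ^ ?L t)"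
        by simp
      also have "\<dots> \<le> weight t * ?b"
      proof -
        have "0 \<le> weight t * ?b"
          using d0 ab N0 weight_nonneg[of t] err_nonneg[OF t] by simp
        then show ?thesis
          using card_le[OF t] by (intro mult_left_le)
      qed
      also have "\<dots> = ?gw t * ?N t + weight t * a ^ ?L t * ?err t"
        unfolding gw[OF t] by (simp add: algebra_simps)
      finally show "(\<Sum>T\<in>embeddings n v t. weight t * measure_pmf.expectation ?M (\<lambda>(G, R, \<sigma>). ?e T G R * ?x \<sigma> G R)) \<le>
        ?gw t * ?N t + weight t * a ^ ?L t * ?err t" .
    qed
    finally show ?thesis .
  qed
  have mass: "measure_pmf.expectation ?M g \<ge>
    (\<Sum>t\<in>S. (1 - length (nodes t) / n) ^ ?L t * (?gw t * (1 - p) ^ ?m t) - weight t * a ^ ?L t * ?err t)"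
  proof -
    have "measure_pmf.expectation ?M g =
        (\<Sum>t\<in>S. \<Sum>T\<in>embeddings n v t. weight t * measure_pmf.expectation ?M (\<lambda>(G, R, \<sigma>). ?e T G R))"
    proof -
      have "g = (\<lambda>\<omega>. \<Sum>t\<in>S. \<Sum>T\<in>embeddings n v t. weight t * (case \<omega> of (G, R, \<sigma>) \<Rightarrow> ?e T G R))"
        by (auto simp: g_def)
      then show ?thesis
        by (simp add: int)
    qed
    also have "\<dots> \<ge> (\<Sum>t\<in>S. (1 - length (nodes t) / n) ^ ?L t * (?gw t * (1 - p) ^ ?m t) - weight t * a ^ ?L t * ?err t)"
    proof (rule sum_mono)
      fix t assume t: "t \<in> S"
      let ?C = "real (card (embeddings n v t)) / n ^ ?L t"
      let ?b = "d ^ ?L t * ?c t * (1 - p) ^ ?m t - a ^ ?L t * ?err t"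
      have "?b / n ^ ?L t \<le> measure_pmf.expectation ?M (\<lambda>(G, R, \<sigma>). ?e T G R)"
        if T: "T \<in> embeddings n v t" for T
        using sbm_embedding.explored_probability[OF loc[OF t T] p]
        unfolding sbm_embedding.c_def[OF loc[OF t T]]
        by (simp add: power_divide diff_divide_distrib)
      then have *: "(\<Sum>T\<in>embeddings n v t. weight t * (?b / n ^ ?L t)) \<le>
          (\<Sum>T\<in>embeddings n v t. weight t * measure_pmf.expectation ?M (\<lambda>(G, R, \<sigma>). ?e T G R))"
        by (intro sum_mono mult_left_mono weight_nonneg)
      have "?C * (?gw t * (1 - p) ^ ?m t) \<ge> (1 - length (nodes t) / n) ^ ?L t * (?gw t * (1 - p) ^ ?m t)"
        using card_ge[OF t] p by (intro mult_right_mono) auto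
      moreover have "?C * (weight t * a ^ ?L t * ?err t) \<le> weight t * a ^ ?L t * ?err t"
        using card_le[OF t] err_nonneg[OF t] weight_nonneg[of t] ab by (intro mult_left_le_one_le) auto
      moreover have "(\<Sum>T\<in>embeddings n v t. weight t * (?b / n ^ ?L t)) =
          ?C * (?gw t * (1 - p) ^ ?m t) - ?C * (weight t * a ^ ?L t * ?err t)"
        unfolding gw[OF t] using n0 by (simp add: field_simps)
      ultimately show "(1 - length (nodes t) / n) ^ ?L t * (?gw t * (1 - p) ^ ?m t) - weight t * a ^ ?L t * ?err t \<le>
          (\<Sum>T\<in>embeddings n v t. weight t * measure_pmf.expectation ?M (\<lambda>(G, R, \<sigma>). ?e T G R))"
        using * by linarith
    qed
    finally show ?thesis .
  qed
  \<comment> \<open>The bound \<open>g \<le> 1\<close> is essential here: it makes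
    \<open>1 - g\<close> a nonnegative factor, so that \<open>x \<le> 1\<close> can be used.\<close>
  have rest: "measure_pmf.expectation ?M (\<lambda>\<omega>. x \<omega> * (1 - g \<omega>)) \<le> measure_pmf.expectation ?M (\<lambda>\<omega>. 1 - g \<omega>)"
  proof (intro expectation_mono_finite finite_set_labeled_sbm k)
    fix \<omega> assume "\<omega> \<in> set_pmf ?M"
    then obtain G R \<sigma> where \<omega>: "\<omega> = (G, R, \<sigma>)" and "G \<in> set_pmf (random_subset (pairs n) (edge_rate n a b \<sigma>))"
      unfolding labeled_sbm_conv by auto
    then have G: "G \<subseteq> pairs n"
      using set_random_subset by blast
    have "g \<omega> \<le> 1"
      unfolding \<omega> g_def using sum_weight_embeddings_le_1[OF S G] by simp
    moreover have "x \<omega> \<le> 1"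
    proof -
      have "\<bar>?h (\<sigma> v)\<bar> \<le> 1"
        using k by (auto simp: of_bool_def divide_simps)
      then have "\<bar>x \<omega>\<bar> \<le> 1"
        unfolding \<omega> x_def by (simp add: abs_mult f mult_le_one del: of_bool_eq)
      then show ?thesis by simp
    qed
    ultimately show "x \<omega> * (1 - g \<omega>) \<le> 1 - g \<omega>"
      using mult_right_mono[of "x \<omega>" 1 "1 - g \<omega>"] by simp
  qed
  have "measure_pmf.expectation ?M x =
      measure_pmf.expectation ?M (\<lambda>\<omega>. x \<omega> * g \<omega>) + measure_pmf.expectation ?M (\<lambda>\<omega>. x \<omega> * (1 - g \<omega>))"
    by (subst Bochner_Integration.integral_add[symmetric, OF int int]) (simp add: algebra_simps)
  moreover have "measure_pmf.expectation ?M (\<lambda>\<omega>. 1 - g \<omega>) = 1 - measure_pmf.expectation ?M g"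
    by (simp add: int)
  ultimately have "measure_pmf.expectation ?M x \<le>
      (\<Sum>t\<in>S. ?gw t * ?N t + weight t * a ^ ?L t * ?err t) + 1 -
      (\<Sum>t\<in>S. (1 - length (nodes t) / n) ^ ?L t * (?gw t * (1 - p) ^ ?m t) - weight t * a ^ ?L t * ?err t)"
    using main mass rest by linarith
  \<comment> \<open>The embedding errors enter once through \<open>main\<close> and once through
    \<open>mass\<close>, hence the factor 2.\<close>
  also have "\<dots> = 1 - (\<Sum>t\<in>S. (1 - length (nodes t) / n) ^ ?L t * (?gw t * (1 - p) ^ ?m t)) +
      (\<Sum>t\<in>S. ?gw t * ?N t) + (\<Sum>t\<in>S. 2 * weight t * a ^ ?L t * ?err t)"
    by (simp add: sum.distrib sum_subtractf sum_distrib_left[symmetric] mult.assoc)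
  finally show "measure_pmf.expectation ?M (\<lambda>\<omega>. (of_bool (case \<omega> of (G, R, \<sigma>) \<Rightarrow> \<sigma> v = i) - 1 / real k) *
         f (case \<omega> of (G, R, \<sigma>) \<Rightarrow> (G, R, restrict \<sigma> R)))
    \<le> 1 - (\<Sum>t\<in>S. (1 - length (nodes t) / n) ^ ?L t * (?gw t * (1 - p) ^ ?m t)) +
      (\<Sum>t\<in>S. ?gw t * ?N t) + (\<Sum>t\<in>S. 2 * weight t * a ^ ?L t * ?err t)"
    by (simp add: x_def case_prod_unfold)
qed

section \<open>The limit over n for fixed shapes and fixed p\<close>

lemma limsup_sbm_posterior_le:
  fixes a b d \<eta> p \<epsilon> :: real and v :: "nat \<Rightarrow> nat"
  assumes k: "k \<ge> 1" and ab: "0 \<le> b" "b < a" and p: "0 \<le> p" "p \<le> 1"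
    and d: "d = (a + (real k - 1) * b) / real k" and \<eta>: "\<eta> = b / (a + (real k - 1) * b)"
    and S: "finite S" "\<And>t. t \<in> S \<Longrightarrow> height_le r t" and v: "\<forall>\<^sub>F n in sequentially. v n \<in> {1..n}"
    and i: "i \<in> {1..k}" and \<epsilon>: "\<epsilon> > 0"
  shows "limsup (\<lambda>n. ereal (measure_pmf.prob (labeled_sbm n k a b p)
      {\<omega>. \<bar>sbm_posterior n k a b p (v n) i \<omega> - 1 / real k\<bar> > \<epsilon>})) \<le>
    ereal ((1 - (\<Sum>t\<in>S. pmf (gw_tree (poisson_pmf d) r) t * (1 - p) ^ length (inner_nodes r t)) +
      (\<Sum>t\<in>S. pmf (gw_tree (poisson_pmf d) r) t * root_information k \<eta> r i t)) / \<epsilon>)"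
proof -
  let ?gw = "pmf (gw_tree (poisson_pmf d) r)"
  let ?P = "\<lambda>n. measure_pmf.prob (labeled_sbm n k a b p)
      {\<omega>. \<bar>sbm_posterior n k a b p (v n) i \<omega> - 1 / real k\<bar> > \<epsilon>}"
  define B where "B = (\<lambda>n. (1 - (\<Sum>t\<in>S. (1 - length (nodes t) / real n) ^ length (edges t) *
          (?gw t * (1 - p) ^ length (inner_nodes r t))) +
      (\<Sum>t\<in>S. ?gw t * root_information k \<eta> r i t) +
      (\<Sum>t\<in>S. 2 * weight t * a ^ length (edges t) * embedding_err r a d t n)) / \<epsilon>)"
  have "B \<longlonglongrightarrow> (1 - (\<Sum>t\<in>S. (1 - 0) ^ length (edges t) * (?gw t * (1 - p) ^ length (inner_nodes r t))) +
      (\<Sum>t\<in>S. ?gw t * root_information k \<eta> r i t) + (\<Sum>t\<in>S. 2 * weight t * a ^ length (edges t) * 0)) / \<epsilon>"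
    unfolding B_def using \<epsilon>
    by (intro tendsto_intros lim_const_over_n tendsto_embedding_err) auto
  then have lim: "(\<lambda>n. ereal (B n)) \<longlonglongrightarrow> ereal ((1 - (\<Sum>t\<in>S. ?gw t * (1 - p) ^ length (inner_nodes r t)) +
      (\<Sum>t\<in>S. ?gw t * root_information k \<eta> r i t)) / \<epsilon>)"
    by simp
  have "\<forall>\<^sub>F n in sequentially. ?P n \<le> B n"
  proof -
    have "\<forall>\<^sub>F n in sequentially. a \<le> real n"
      by real_asymp
    moreover have "\<forall>\<^sub>F n in sequentially. \<forall>t\<in>S. real (length (nodes t)) * d \<le> real n"
      using S(1) eventually_ge_at_top[of "real (length (nodes t)) * d" for t]
      by (intro eventually_ball_finite ballI)
         (auto intro!: filterlim_real_sequentially[unfolded filterlim_at_top, rule_format])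
    moreover have "\<forall>\<^sub>F n in sequentially. \<forall>t\<in>S. length (nodes t) < n"
      using S(1) by (intro eventually_ball_finite ballI eventually_gt_at_top)
    ultimately show ?thesis
      using v
    proof eventually_elim
      case (elim n)
      have "?P n \<le> measure_pmf.expectation (labeled_sbm n k a b p)
          (\<lambda>\<omega>. \<bar>sbm_posterior n k a b p (v n) i \<omega> - 1 / real k\<bar>) / \<epsilon>"
        by (rule prob_gt_le_expectation[OF finite_set_labeled_sbm[OF k] \<epsilon>])
      also have "\<dots> \<le> B n"
        unfolding B_def using elim \<epsilon>
        by (intro divide_right_mono sbm_posterior_deviation_le k ab p d \<eta> S i) auto
      finally show ?case .
    qed
  qed
  then have "limsup (\<lambda>n. ereal (?P n)) \<le> limsup (\<lambda>n. ereal (B n))"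
    by (intro Limsup_mono) auto
  also have "\<dots> = ereal ((1 - (\<Sum>t\<in>S. ?gw t * (1 - p) ^ length (inner_nodes r t)) +
      (\<Sum>t\<in>S. ?gw t * root_information k \<eta> r i t)) / \<epsilon>)"
    using lim by (intro lim_imp_Limsup) auto
  finally show ?thesis .
qed

section \<open>Choosing the depth and the shapes\<close>

lemma root_information_le:
  assumes "k \<ge> 1" "0 \<le> \<eta>" "0 \<le> \<epsilon>"
  shows "root_information k \<eta> r i t \<le>
    \<epsilon> + measure_pmf.prob (broadcast k \<eta> t) {\<tau>. \<bar>root_posterior k \<eta> r i t \<tau> - 1 / k\<bar> > \<epsilon>}"
proof -
  let ?X = "\<lambda>\<tau>. \<bar>root_posterior k \<eta> r i t \<tau> - 1 / k\<bar>"
  have fin: "finite (set_pmf (broadcast k \<eta> t))"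
    using set_broadcast[OF assms(1,2)] finite_labelings by (rule finite_subset)
  have "?X \<tau> \<le> 1" for \<tau>
  proof -
    have "0 \<le> root_posterior k \<eta> r i t \<tau>"
      unfolding root_posterior_def posterior_def cond_prob_def by simp
    moreover have "root_posterior k \<eta> r i t \<tau> \<le> 1"
      unfolding root_posterior_def posterior_def cond_prob_def
      by (intro divide_le_eq_1[THEN iffD2]) (auto intro!: measure_pmf.finite_measure_mono simp: less_le)
    moreover have "0 \<le> 1 / real k" "1 / real k \<le> 1"
      using assms(1) by auto
    ultimately show ?thesis
      by linarith
  qed
  then have "root_information k \<eta> r i t \<le>
      measure_pmf.expectation (broadcast k \<eta> t) (\<lambda>\<tau>. \<epsilon> + indicator {\<tau>. ?X \<tau> > \<epsilon>} \<tau>)"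
    unfolding root_information_def using assms(3)
    by (intro expectation_mono_finite fin) (auto simp: indicator_def intro: add_increasing)
  then show ?thesis
    by (simp add: integrable_measure_pmf_finite[OF fin])
qed

text \<open>The left side is the part of the mixture whose first stage lies in \<open>S\<close>. The
  argument runs through nonnegative integrals because the Galton-Watson law has infinite
  support.\<close>

lemma sum_pmf_le_prob_bind:
  assumes "finite S"
  shows "(\<Sum>t\<in>S. pmf M t * measure_pmf.prob (N t) A) \<le> measure_pmf.prob (bind_pmf M N) A"
proof -
  have "ennreal (\<Sum>t\<in>S. pmf M t * measure_pmf.prob (N t) A) =
      (\<Sum>t\<in>S. ennreal (measure_pmf.prob (N t) A) * ennreal (pmf M t))"
    by (simp add: ennreal_mult[symmetric] mult.commute)
  also have "\<dots> = (\<integral>\<^sup>+t. ennreal (measure_pmf.prob (N t) A) * indicator S t \<partial>M)"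
    using assms by (subst nn_integral_measure_pmf_support[of S]) (auto intro!: sum.cong)
  also have "\<dots> \<le> (\<integral>\<^sup>+t. emeasure (N t) A \<partial>M)"
    by (intro nn_integral_mono) (auto simp: measure_pmf.emeasure_eq_measure indicator_def)
  also have "\<dots> = ennreal (measure_pmf.prob (bind_pmf M N) A)"
    by (simp add: measure_pmf.emeasure_eq_measure[symmetric])
  finally show ?thesis
    by simp
qed

text \<open>Half of \<open>\<delta>\<close> is the deviation that is tolerated, the other half the
  probability of exceeding it. The bound is uniform in \<open>S\<close>, since the set of shapes can
  be chosen only after the depth \<open>r\<close>.\<close>

lemma nonreconstruction_root_information:
  assumes "nonreconstruction k d \<eta>" "k \<ge> 1" "0 \<le> \<eta>" "i \<in> {1..k}" "\<delta> > 0"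
  obtains r where "\<And>S. finite S \<Longrightarrow>
    (\<Sum>t\<in>S. pmf (gw_tree (poisson_pmf d) r) t * root_information k \<eta> r i t) \<le> \<delta>"
proof -
  let ?A = "\<lambda>r. {(T, \<tau>). \<bar>root_posterior k \<eta> r i T \<tau> - 1 / real k\<bar> > \<delta> / 2}"
  have "(\<lambda>r. measure_pmf.prob (gw_broadcast k d \<eta> r) (?A r)) \<longlonglongrightarrow> 0"
    using assms(1,4,5) unfolding nonreconstruction_def by (meson half_gt_zero)
  then have "\<forall>\<^sub>F r in sequentially. measure_pmf.prob (gw_broadcast k d \<eta> r) (?A r) < \<delta> / 2"
    using assms(5) by (intro order_tendstoD) auto
  then obtain r where r: "measure_pmf.prob (gw_broadcast k d \<eta> r) (?A r) < \<delta> / 2"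
    by (auto simp: eventually_sequentially)
  let ?gw = "pmf (gw_tree (poisson_pmf d) r)"
  have "(\<Sum>t\<in>S. ?gw t * root_information k \<eta> r i t) \<le> \<delta>" if S: "finite S" for S
  proof -
    have "(\<Sum>t\<in>S. ?gw t * root_information k \<eta> r i t) \<le> (\<Sum>t\<in>S. ?gw t * (\<delta> / 2 +
        measure_pmf.prob (broadcast k \<eta> t) {\<tau>. \<bar>root_posterior k \<eta> r i t \<tau> - 1 / k\<bar> > \<delta> / 2}))"
      using assms by (intro sum_mono mult_left_mono root_information_le) auto
    also have "\<dots> = \<delta> / 2 * (\<Sum>t\<in>S. ?gw t) +
        (\<Sum>t\<in>S. ?gw t * measure_pmf.prob (map_pmf (Pair t) (broadcast k \<eta> t)) (?A r))"
      by (simp add: algebra_simps sum.distrib sum_distrib_left vimage_def)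
    also have "\<dots> \<le> \<delta> / 2 * 1 +
        measure_pmf.prob (bind_pmf (gw_tree (poisson_pmf d) r) (\<lambda>t. map_pmf (Pair t) (broadcast k \<eta> t))) (?A r)"
    proof (intro add_mono mult_left_mono sum_pmf_le_prob_bind S)
      show "sum ?gw S \<le> 1"
        using measure_measure_pmf_finite[OF S, symmetric] by simp
    qed (use assms in auto)
    also have "bind_pmf (gw_tree (poisson_pmf d) r) (\<lambda>t. map_pmf (Pair t) (broadcast k \<eta> t)) =
        gw_broadcast k d \<eta> r"
      by (simp add: gw_broadcast_def map_pmf_def)
    finally show ?thesis
      using r by simp
  qed
  then show thesis
    by (rule that)
qed

text \<open>A countable support is exhausted by the finite initial pieces of an enumeration. The
  reduction to finitely many shapes allows the limit over \<open>n\<close> to be taken shape by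
  shape; their membership in the support bounds their heights.\<close>

lemma finite_pmf_approx:
  fixes M :: "'a pmf"
  assumes "\<delta> > 0"
  obtains S where "finite S" "S \<subseteq> set_pmf M" "(\<Sum>x\<in>S. pmf M x) > 1 - \<delta>"
proof -
  define A where "A = (\<lambda>n. from_nat_into (set_pmf M) ` {..n})"
  have "(\<Union>n. A n) = range (from_nat_into (set_pmf M))"
    by (auto simp: A_def)
  also have "\<dots> = set_pmf M"
    by (rule range_from_nat_into[OF set_pmf_not_empty countable_set_pmf])
  finally have un: "(\<Union>n. A n) = set_pmf M" .
  have "(\<lambda>n. measure_pmf.prob M (A n)) \<longlonglongrightarrow> measure_pmf.prob M (\<Union>n. A n)"
    by (rule measure_pmf.finite_Lim_measure_incseq) (auto simp: incseq_def A_def)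
  also have "measure_pmf.prob M (\<Union>n. A n) = 1"
    unfolding un by (simp add: measure_pmf.emeasure_eq_measure[symmetric] measure_pmf.prob_eq_1 AE_measure_pmf)
  finally have "\<forall>\<^sub>F n in sequentially. measure_pmf.prob M (A n) > 1 - \<delta>"
    using assms by (intro order_tendstoD) auto
  then obtain n where n: "measure_pmf.prob M (A n) > 1 - \<delta>"
    by (auto simp: eventually_sequentially)
  have "finite (A n)" "A n \<subseteq> set_pmf M"
    using un by (auto simp: A_def)
  with n show thesis
    by (intro that[of "A n"]) (auto simp: measure_measure_pmf_finite)
qed

text \<open>The phrase a.a.s. is read as convergence in probability. The limit superior over
  \<open>n\<close> avoids presupposing a limit of the deviation probabilities, and the vertex may
  vary with \<open>n\<close>.\<close>

theorem theorem2:
  fixes k :: nat and a b :: real and v :: "nat \<Rightarrow> nat" and \<pi> :: "real \<Rightarrow> real \<Rightarrow> bool"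
  assumes "k \<ge> 1" and "b \<ge> 0" and "a > b" and "a + (real k - 1) * b > real k"
    and "\<forall>\<^sub>F n in sequentially. v n \<in> {1..n}"
    and "reconstruction_predicate k \<pi>"
    and "\<not> theta \<pi> k a b"
  shows "\<forall>i\<in>{1..k}. \<forall>\<epsilon>>0.
    ((\<lambda>p. limsup (\<lambda>n. ereal (measure_pmf.prob (labeled_sbm n k a b p)
        {\<omega>. \<bar>sbm_posterior n k a b p (v n) i \<omega> - 1 / real k\<bar> > \<epsilon>}))) \<longlongrightarrow> 0) (at_right 0)"
proof (intro ballI allI impI)
  fix i and \<epsilon> :: real
  assume i: "i \<in> {1..k}" and \<epsilon>: "\<epsilon> > 0"
  define d where "d = (a + (real k - 1) * b) / real k"
  define \<eta> where "\<eta> = b / (a + (real k - 1) * b)"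
  have pos: "a + (real k - 1) * b > 0"
    using assms(4) by linarith
  \<comment> \<open>The last inequality amounts to \<open>b < a\<close>, and the first to the
    assumption \<open>a + (k - 1) * b > k\<close>.\<close>
  have "1 < d" "0 \<le> \<eta>" "\<eta> < 1 / real k"
    using assms(1-4) pos by (auto simp: d_def \<eta>_def field_simps)
  moreover have "\<not> \<pi> d \<eta>"
    using assms(7) by (simp add: theta_def d_def \<eta>_def)
  ultimately have nonrec: "nonreconstruction k d \<eta>"
    using assms(6) unfolding reconstruction_predicate_def by blast
  let ?F = "\<lambda>p. limsup (\<lambda>n. ereal (measure_pmf.prob (labeled_sbm n k a b p)
        {\<omega>. \<bar>sbm_posterior n k a b p (v n) i \<omega> - 1 / real k\<bar> > \<epsilon>}))"
  show "(?F \<longlongrightarrow> 0) (at_right 0)"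
  proof (rule order_tendstoI)
    fix y :: ereal assume y: "y < 0"
    have "0 \<le> ?F p" for p
      by (intro le_Limsup) auto
    then show "\<forall>\<^sub>F p in at_right 0. y < ?F p"
      using y by (auto intro!: always_eventually intro: less_le_trans)
  next
    fix y :: ereal assume "0 < y"
    then obtain z where z: "0 < z" "ereal z < y"
      using ereal_dense2[of 0 y] by auto
    \<comment> \<open>At \<open>p = 0\<close> the neglected shapes contribute less than
      \<open>\<delta>\<close> and the root posterior at most \<open>\<delta>\<close>; after division
      by \<open>\<epsilon>\<close> from Markov's inequality, the sum \<open>2 * \<delta>\<close>
      becomes \<open>z\<close>.\<close>
    define \<delta> where "\<delta> = z * \<epsilon> / 2"
    have \<delta>: "\<delta> > 0"
      using z \<epsilon> by (simp add: \<delta>_def)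
    obtain r where r: "\<And>S. finite S \<Longrightarrow>
        (\<Sum>t\<in>S. pmf (gw_tree (poisson_pmf d) r) t * root_information k \<eta> r i t) \<le> \<delta>"
      using nonreconstruction_root_information[OF nonrec assms(1) \<open>0 \<le> \<eta>\<close> i \<delta>] by blast
    let ?gw = "pmf (gw_tree (poisson_pmf d) r)"
    obtain S where S: "finite S" "S \<subseteq> set_pmf (gw_tree (poisson_pmf d) r)" "(\<Sum>t\<in>S. ?gw t) > 1 - \<delta>"
      by (rule finite_pmf_approx[OF \<delta>])
    define g where "g = (\<lambda>p. (1 - (\<Sum>t\<in>S. ?gw t * (1 - p) ^ length (inner_nodes r t)) + \<delta>) / \<epsilon>)"
    \<comment> \<open>With \<open>r\<close> and \<open>S\<close> fixed before \<open>p\<close>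
      varies, \<open>g\<close> is a fixed polynomial in \<open>p\<close>; by continuity the cost of
      revealed inner vertices disappears as \<open>p\<close> tends to 0.\<close>
    have "(g \<longlongrightarrow> (1 - (\<Sum>t\<in>S. ?gw t * (1 - 0) ^ length (inner_nodes r t)) + \<delta>) / \<epsilon>) (at_right 0)"
      unfolding g_def using \<epsilon> by (intro tendsto_intros) auto
    moreover have "(1 - (\<Sum>t\<in>S. ?gw t * (1 - 0) ^ length (inner_nodes r t)) + \<delta>) / \<epsilon> < z"
      using S(3) \<epsilon> by (simp add: \<delta>_def field_simps)
    ultimately have "\<forall>\<^sub>F p in at_right 0. g p < z"
      by (rule order_tendstoD)
    moreover have "\<forall>\<^sub>F p in at_right (0::real). p \<in> {0<..<1}"
      by (rule eventually_at_right_real) simp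
    ultimately show "\<forall>\<^sub>F p in at_right 0. ?F p < y"
    proof eventually_elim
      case (elim p)
      have "?F p \<le> ereal ((1 - (\<Sum>t\<in>S. ?gw t * (1 - p) ^ length (inner_nodes r t)) +
          (\<Sum>t\<in>S. ?gw t * root_information k \<eta> r i t)) / \<epsilon>)"
        using elim S(2) height_le_gw_tree
        by (intro limsup_sbm_posterior_le assms(1,2,3,5) d_def \<eta>_def S(1) i \<epsilon>) auto
      also have "\<dots> \<le> ereal (g p)"
        using r[OF S(1)] \<epsilon> by (simp add: g_def divide_right_mono)
      also have "\<dots> < ereal z"
        using elim by simp
      also have "\<dots> < y"
        by (rule z)
      finally show ?case .
    qed
  qed
qed

end
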